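(* $Z^0(\mathbb R^2)$ is continuously embedded in $H^{2/3}_xL^2_z=H^{2/3}(\mathbb R;L^2(\mathbb R))$: there is $C>0$ such that $\|\phi\|_{H^{2/3}_xL^2_z}\le C\|\phi\|_{Z^0}$ for all $\phi\in Z^0(\mathbb R^2)$.
   Context: For an open set $\mathcal O\subset\mathbb R^2$ with coordinates $(x,z)$, $Z^0(\mathcal O)$ is the space of $\phi$ such that $\phi,\partial_z\phi,\partial_{zz}\phi$ and $z\partial_x\phi$ belong to $L^2(\mathcal O)$ (distributional derivatives), with norm $\|\phi\|_{Z^0}=\|z\partial_x\phi\|_{L^2}+\|\partial_{zz}\phi\|_{L^2}+\|\partial_z\phi\|_{L^2}+\|\phi\|_{L^2}$. *)

theory Defs
  imports "HOL-Analysis.Analysis"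
begin

definition pderiv2 :: "bool \<Rightarrow> (real \<times> real \<Rightarrow> real) \<Rightarrow> real \<times> real \<Rightarrow> real" where
  "pderiv2 d f = (\<lambda>(x, z). if d then deriv (\<lambda>t. f (x, t)) z else deriv (\<lambda>t. f (t, z)) x)"

definition partial_exists :: "bool \<Rightarrow> (real \<times> real \<Rightarrow> real) \<Rightarrow> bool" where
  "partial_exists d f \<longleftrightarrow> (\<forall>x z. if d then (\<lambda>t. f (x, t)) differentiable (at z)
                                        else (\<lambda>t. f (t, z)) differentiable (at x))"

definition pderivs2 :: "bool list \<Rightarrow> (real \<times> real \<Rightarrow> real) \<Rightarrow> real \<times> real \<Rightarrow> real" where
  "pderivs2 ds f = foldr pderiv2 ds f"

definition smooth2 :: "(real \<times> real \<Rightarrow> real) \<Rightarrow> bool" where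
  "smooth2 f \<longleftrightarrow> (\<forall>ds. continuous_on UNIV (pderivs2 ds f) \<and> (\<forall>d. partial_exists d (pderivs2 ds f)))"

definition test_fun :: "(real \<times> real \<Rightarrow> real) \<Rightarrow> bool" where
  "test_fun \<psi> \<longleftrightarrow> smooth2 \<psi> \<and> compact (closure {p. \<psi> p \<noteq> 0})"

definition L2 :: "(real \<times> real \<Rightarrow> real) \<Rightarrow> bool" where
  "L2 f \<longleftrightarrow> f \<in> borel_measurable lborel \<and> integrable lborel (\<lambda>p. (f p)\<^sup>2)"

definition L2_norm :: "(real \<times> real \<Rightarrow> real) \<Rightarrow> real" where
  "L2_norm f = sqrt (\<integral>p. (f p)\<^sup>2 \<partial>lborel)"

definition weak_dz :: "(real \<times> real \<Rightarrow> real) \<Rightarrow> (real \<times> real \<Rightarrow> real) \<Rightarrow> bool" where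
  "weak_dz \<phi> g \<longleftrightarrow> (\<forall>\<psi>. test_fun \<psi> \<longrightarrow>
      (\<integral>p. \<phi> p * pderiv2 True \<psi> p \<partial>lborel) = - (\<integral>p. g p * \<psi> p \<partial>lborel))"

definition weak_dzz :: "(real \<times> real \<Rightarrow> real) \<Rightarrow> (real \<times> real \<Rightarrow> real) \<Rightarrow> bool" where
  "weak_dzz \<phi> g \<longleftrightarrow> (\<forall>\<psi>. test_fun \<psi> \<longrightarrow>
      (\<integral>p. \<phi> p * pderiv2 True (pderiv2 True \<psi>) p \<partial>lborel) = (\<integral>p. g p * \<psi> p \<partial>lborel))"

text \<open>g = z \<partial>_x \<phi> as distributions: <z \<partial>_x \<phi>, \<psi>> = - \<integral> \<phi> \<partial>_x(z \<psi>) = - \<integral> \<phi> z \<partial>_x \<psi>.\<close>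
definition weak_z_dx :: "(real \<times> real \<Rightarrow> real) \<Rightarrow> (real \<times> real \<Rightarrow> real) \<Rightarrow> bool" where
  "weak_z_dx \<phi> g \<longleftrightarrow> (\<forall>\<psi>. test_fun \<psi> \<longrightarrow>
      (\<integral>p. \<phi> p * (snd p * pderiv2 False \<psi> p) \<partial>lborel) = - (\<integral>p. g p * \<psi> p \<partial>lborel))"

text \<open>Squared H^{2/3}(R; L^2(R)) norm (Sobolev--Slobodeckij / Gagliardo form, s = 2/3):
  \<parallel>\<phi>\<parallel>^2_{L^2} + \<integral>\<integral> \<parallel>\<phi>(x,.) - \<phi>(y,.)\<parallel>^2_{L^2_z} / |x-y|^{1+2s} dx dy.\<close>
definition H23_sq :: "(real \<times> real \<Rightarrow> real) \<Rightarrow> ennreal" where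
  "H23_sq \<phi> = (\<integral>\<^sup>+p. ennreal ((\<phi> p)\<^sup>2) \<partial>lborel)
     + (\<integral>\<^sup>+x. \<integral>\<^sup>+y. \<integral>\<^sup>+z. ennreal ((\<phi> (x, z) - \<phi> (y, z))\<^sup>2 / \<bar>x - y\<bar> powr (7/3))
          \<partial>lborel \<partial>lborel \<partial>lborel)"

definition H23_norm :: "(real \<times> real \<Rightarrow> real) \<Rightarrow> real" where
  "H23_norm \<phi> = sqrt (enn2real (H23_sq \<phi>))"

end

theory Submission
  imports Defs
begin

text \<open>
  Write \<open>D\<^sub>h\<close> for the increment by \<open>h > 0\<close> in \<open>x\<close> and put \<open>d = h\<^bsup>1/3\<^esup>\<close>. Where \<open>|z| \<ge> d\<close>, the bound on
  \<open>z \<partial>\<^sub>x \<phi>\<close> gives \<open>\<parallel>D\<^sub>h \<phi>(\<cdot>, z)\<parallel> \<le> h \<parallel>g\<^sub>x(\<cdot>, z)\<parallel> / |z|\<close>, and integrating the square against \<open>h\<^bsup>-7/3\<^esup>\<close>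
  over \<open>h \<le> |z|\<^sup>3\<close> yields a multiple of \<open>|z|\<^sup>2\<close>, cancelling the denominator. Where \<open>|z| < d\<close>, the second difference of \<open>\<phi>\<close> in \<open>z\<close> with
  step \<open>2d\<close> expresses \<open>D\<^sub>h \<phi>(\<cdot>, z)\<close> by \<open>D\<^sub>h \<phi>\<close> at heights \<open>z + 2d\<close> and \<open>z + 4d\<close>, which lie in the first
  region, up to integrals of \<open>\<partial>\<^sub>z\<^sub>z \<phi>\<close> over \<open>|s| \<le> 5d\<close>. After integration in \<open>h\<close> these are controlled
  by Hardy's inequality, in the form of Cauchy--Schwarz with the weight \<open>|s|\<^bsup>1/2\<^esup>\<close>. (Using the bounds
  for each \<open>h\<close> separately would only give the Besov space with third index infinity.)
\<close>

section \<open>Smooth functions of one variable\<close>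

text \<open>The derivative is an existential witness rather than \<open>deriv f\<close>, so each
  closure property is one induction with the function generalised and the derivative supplied by the
  calculus rule.\<close>

fun Ck :: "nat \<Rightarrow> (real \<Rightarrow> real) \<Rightarrow> bool" where
  "Ck 0 f \<longleftrightarrow> continuous_on UNIV f"
| "Ck (Suc n) f \<longleftrightarrow> (\<exists>f'. (\<forall>x. (f has_real_derivative f' x) (at x)) \<and> Ck n f')"

definition smooth1 :: "(real \<Rightarrow> real) \<Rightarrow> bool" where
  "smooth1 f \<longleftrightarrow> (\<forall>n. Ck n f)"

lemma continuous_if_deriv: "(\<And>x. (f has_real_derivative f' x) (at x)) \<Longrightarrow> continuous_on UNIV f"
  by (meson DERIV_isCont continuous_at_imp_continuous_on)

lemma Ck_Suc_imp: "Ck (Suc n) f \<Longrightarrow> Ck n f"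
proof (induction n arbitrary: f)
  case 0
  then show ?case by (auto intro: continuous_if_deriv)
next
  case (Suc n)
  then show ?case by (metis Ck.simps(2))
qed

lemma Ck_const: "Ck n (\<lambda>x. c)"
  by (induction n arbitrary: c) (auto intro!: exI[of _ "\<lambda>x. 0"])

lemma Ck_add: "Ck n f \<Longrightarrow> Ck n g \<Longrightarrow> Ck n (\<lambda>x. f x + g x)"
proof (induction n arbitrary: f g)
  case 0
  then show ?case by (auto intro: continuous_intros)
next
  case (Suc n)
  then obtain f' g' where "\<And>x. (f has_real_derivative f' x) (at x)" "Ck n f'"
    "\<And>x. (g has_real_derivative g' x) (at x)" "Ck n g'" by auto
  with Suc.IH show ?case
    by (auto intro!: exI[of _ "\<lambda>x. f' x + g' x"] derivative_intros)
qed

lemma Ck_mult: "Ck n f \<Longrightarrow> Ck n g \<Longrightarrow> Ck n (\<lambda>x. f x * g x)"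
proof (induction n arbitrary: f g)
  case 0
  then show ?case by (auto intro: continuous_intros)
next
  case (Suc n)
  then obtain f' g' where d: "\<And>x. (f has_real_derivative f' x) (at x)" "Ck n f'"
    "\<And>x. (g has_real_derivative g' x) (at x)" "Ck n g'" by auto
  \<comment> \<open>The product rule pairs a derivative of class \<open>Ck n\<close> with an
    undifferentiated factor of class \<open>Ck (Suc n)\<close>, which must first be lowered to
    \<open>Ck n\<close>.\<close>
  have "Ck n (\<lambda>x. f x * g' x + f' x * g x)"
    using Suc Ck_Suc_imp[OF Suc.prems(1)] Ck_Suc_imp[OF Suc.prems(2)] d by (intro Ck_add) auto
  moreover have "((\<lambda>x. f x * g x) has_real_derivative f x * g' x + f' x * g x) (at x)" for x
    by (rule DERIV_mult'[OF d(1) d(3)])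
  ultimately show ?case unfolding Ck.simps by (intro exI conjI allI)
qed

lemma Ck_affine: "Ck n f \<Longrightarrow> Ck n (\<lambda>x. f (c * x + d))"
proof (induction n arbitrary: f)
  case 0
  then show ?case by (auto intro!: continuous_intros continuous_on_compose2[of UNIV f])
next
  case (Suc n)
  then obtain f' where d: "\<And>x. (f has_real_derivative f' x) (at x)" "Ck n f'" by auto
  have "Ck n (\<lambda>x. f' (c * x + d) * c)"
    by (rule Ck_mult[OF Suc.IH[OF d(2)] Ck_const])
  moreover have "((\<lambda>x. f (c * x + d)) has_real_derivative f' (c * x + d) * c) (at x)" for x
    by (rule DERIV_chain'[where g=f, OF _ d(1)]) (auto intro!: derivative_eq_intros)
  ultimately show ?case unfolding Ck.simps by (intro exI conjI allI)
qed

lemma smooth1_mult: "smooth1 f \<Longrightarrow> smooth1 g \<Longrightarrow> smooth1 (\<lambda>x. f x * g x)"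
  and smooth1_affine: "smooth1 f \<Longrightarrow> smooth1 (\<lambda>x. f (c * x + d))"
  by (simp_all add: smooth1_def Ck_mult Ck_affine)

lemma smooth1_antiderivative:
  assumes "\<And>x. (F has_real_derivative f x) (at x)" "smooth1 f"
  shows "smooth1 F"
  unfolding smooth1_def
proof
  fix n
  have "Ck (Suc n) F" using assms unfolding smooth1_def Ck.simps by blast
  then show "Ck n F" by (rule Ck_Suc_imp)
qed

text \<open>Each order n brings its own witness for the first derivative; uniqueness of derivatives
  identifies all of them with \<open>deriv f\<close>, which is therefore of class
  \<open>Ck n\<close> for every n.\<close>

lemma smooth1_deriv:
  assumes "smooth1 f"
  shows "(f has_real_derivative deriv f x) (at x)" "smooth1 (deriv f)"
proof -
  have *: "\<exists>f'. (\<forall>x. (f has_real_derivative f' x) (at x)) \<and> Ck n f'" for n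
    using assms unfolding smooth1_def Ck.simps(2)[symmetric] by blast
  have eq: "f' = deriv f" if "\<forall>x. (f has_real_derivative f' x) (at x)" for f'
    using that by (intro ext DERIV_imp_deriv[symmetric]) blast
  show "(f has_real_derivative deriv f x) (at x)"
    using *[of 0] eq by blast
  show "smooth1 (deriv f)"
    unfolding smooth1_def
  proof
    show "Ck n (deriv f)" for n using *[of n] eq by blast
  qed
qed

lemma smooth1_continuous: "smooth1 f \<Longrightarrow> continuous_on UNIV f"
  unfolding smooth1_def Ck.simps(1)[symmetric] by blast

section \<open>The flat function exp(-1/x) and its derivatives\<close>

definition exp_inv :: "real poly \<Rightarrow> real \<Rightarrow> real" where
  "exp_inv p x = (if x > 0 then poly p (1 / x) * exp (- 1 / x) else 0)"

lemma poly_mult_exp_minus_tendsto_0: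
  "((\<lambda>y. poly p y * exp (- y)) \<longlongrightarrow> (0::real)) at_top"
proof -
  have "((\<lambda>y. \<Sum>i\<le>degree p. coeff p i * (y ^ i / exp y)) \<longlongrightarrow> (\<Sum>i\<le>degree p. coeff p i * 0)) at_top"
    by (intro tendsto_intros tendsto_power_div_exp_0)
  then show ?thesis
    by (simp add: poly_altdef sum_distrib_right exp_minus divide_inverse mult.assoc)
qed

lemma exp_inv_tendsto_0: "(exp_inv p \<longlongrightarrow> 0) (at 0)"
proof -
  have "((\<lambda>x. poly p (inverse x) * exp (- inverse x)) \<longlongrightarrow> 0) (at_right 0)"
    by (rule filterlim_compose[OF poly_mult_exp_minus_tendsto_0 filterlim_inverse_at_top_right])
  then have "(exp_inv p \<longlongrightarrow> 0) (at_right 0)"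
    by (rule Lim_transform_eventually)
       (auto simp: exp_inv_def divide_inverse eventually_at_filter)
  moreover have "(exp_inv p \<longlongrightarrow> 0) (at_left 0)"
    by (rule Lim_transform_eventually[OF tendsto_const])
       (auto simp: exp_inv_def eventually_at_filter)
  ultimately show ?thesis
    using filterlim_split_at_real by blast
qed

text \<open>With y = 1/x, the x-derivative of p(y) exp(-y) is y^2 (p(y) - p'(y)) exp(-y), and
  \<open>[:0, 0, 1:]\<close> is the factor y^2. The polynomial parameter makes the family
  \<open>exp_inv p\<close> closed under differentiation.\<close>

lemma exp_inv_deriv:
  "(exp_inv p has_real_derivative exp_inv ([:0, 0, 1:] * (p - pderiv p)) x) (at x)"
proof -
  consider "x > 0" | "x < 0" | "x = 0" by linarith
  then show ?thesis
  proof cases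
    case 1
    have "((\<lambda>x. poly p (1 / x) * exp (- 1 / x)) has_real_derivative
        exp_inv ([:0, 0, 1:] * (p - pderiv p)) x) (at x)"
      using 1 by (auto intro!: derivative_eq_intros DERIV_chain'[where g="poly p", OF _ poly_DERIV]
          simp: exp_inv_def field_simps power2_eq_square)
    then show ?thesis
      by (rule DERIV_cong_ev[THEN iffD1, rotated -1])
         (use 1 in \<open>auto simp: exp_inv_def eventually_nhds intro!: exI[of _ "{0<..}"]\<close>)
  next
    case 2
    have "((\<lambda>x. 0) has_real_derivative 0) (at x)" by simp
    then show ?thesis
      by (rule DERIV_cong_ev[THEN iffD1, rotated -1])
         (use 2 in \<open>auto simp: exp_inv_def eventually_nhds intro!: exI[of _ "{..<0}"]\<close>)
  next
    case 3
    \<comment> \<open>Division by h multiplies the polynomial in 1/h by one more power, so the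
      difference quotient at 0 is again a member of the family and tends to 0.\<close>
    have "((\<lambda>h. (exp_inv p (0 + h) - exp_inv p 0) / h) \<longlongrightarrow> 0) (at 0)"
    proof (rule Lim_transform_eventually[OF exp_inv_tendsto_0[of "[:0, 1:] * p"]])
      show "\<forall>\<^sub>F x in at 0. exp_inv ([:0, 1:] * p) x = (exp_inv p (0 + x) - exp_inv p 0) / x"
        by (auto simp: exp_inv_def)
    qed
    then show ?thesis
      unfolding DERIV_def using 3 by (simp add: exp_inv_def)
  qed
qed

lemma smooth1_exp_inv: "smooth1 (exp_inv p)"
  unfolding smooth1_def
proof
  show "Ck n (exp_inv p)" for n
  proof (induction n arbitrary: p)
    case 0
    show ?case by (auto intro: continuous_if_deriv exp_inv_deriv)
  next
    case (Suc n)
    then show ?case using exp_inv_deriv by auto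
  qed
qed

section \<open>Compactly supported smooth functions and their window integrals\<close>

definition csmooth1 :: "(real \<Rightarrow> real) \<Rightarrow> bool" where
  "csmooth1 f \<longleftrightarrow> smooth1 f \<and> (\<exists>M. \<forall>x. \<bar>x\<bar> > M \<longrightarrow> f x = 0)"

lemma csmooth1_deriv:
  assumes "csmooth1 f"
  shows "csmooth1 (deriv f)"
proof -
  obtain M where M: "\<And>x. \<bar>x\<bar> > M \<Longrightarrow> f x = 0" and f: "smooth1 f"
    using assms by (auto simp: csmooth1_def)
  have "deriv f x = 0" if x: "\<bar>x\<bar> > M" for x
  proof -
    have "((\<lambda>x. 0) has_real_derivative 0) (at x)" by simp
    then have "(f has_real_derivative 0) (at x)"
    proof (rule has_field_derivative_transform_within_open)
      show "open {y. M < \<bar>y\<bar>}" by (intro open_Collect_less continuous_intros)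
    qed (use x M in auto)
    then show ?thesis by (rule DERIV_imp_deriv)
  qed
  with smooth1_deriv(2)[OF f] show ?thesis by (auto simp: csmooth1_def)
qed

lemma csmooth1_bounded:
  assumes "csmooth1 f"
  shows "\<exists>B. \<forall>x. \<bar>f x\<bar> \<le> B"
proof -
  obtain M where M: "\<And>x. \<bar>x\<bar> > M \<Longrightarrow> f x = 0" and f: "smooth1 f"
    using assms by (auto simp: csmooth1_def)
  have "compact (f ` {-M..M})"
    by (rule compact_continuous_image[OF continuous_on_subset[OF smooth1_continuous[OF f]]]) auto
  then obtain B where B: "\<And>x. x \<in> {-M..M} \<Longrightarrow> \<bar>f x\<bar> \<le> B"
    by (force dest!: compact_imp_bounded simp: bounded_iff)
  have "\<bar>f x\<bar> \<le> max B 0" for x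
    using B[of x] M[of x] by (cases "\<bar>x\<bar> > M") (fastforce simp: le_max_iff_disj abs_le_iff not_less)+
  then show ?thesis by blast
qed

lemma antiderivative_exists:
  fixes f :: "real \<Rightarrow> real"
  assumes "continuous_on UNIV f"
  shows "\<exists>F. \<forall>x. (F has_real_derivative f x) (at x)"
proof -
  obtain F where "\<And>x::real. - \<infinity> < ereal x \<Longrightarrow> ereal x < \<infinity> \<Longrightarrow> (F has_vector_derivative f x) (at x)"
    using einterval_antiderivative[of "-\<infinity>" "\<infinity>" f] assms
    by (auto simp: continuous_on_eq_continuous_at)
  then show ?thesis
    by (auto simp: has_real_derivative_iff_has_vector_derivative)
qed

text \<open>F(x) is A(x) - A(x - h) for an antiderivative A of f. As a factor of a test function, F
  turns a weak derivative into a finite increment: its derivative is the increment of f, and its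
  support is bounded, while that of A need not be.\<close>

lemma csmooth1_window_integral:
  assumes "csmooth1 f" "h > 0"
  defines "F \<equiv> \<lambda>x. \<integral>t. indicator {0..h} t * f (x - t) \<partial>lborel"
  shows "csmooth1 F" "deriv F x = f x - f (x - h)"
proof -
  obtain M where M: "\<And>x. \<bar>x\<bar> > M \<Longrightarrow> f x = 0" and f: "smooth1 f"
    using assms by (auto simp: csmooth1_def)
  obtain A where A: "\<And>x. (A has_real_derivative f x) (at x)"
    using antiderivative_exists[OF smooth1_continuous[OF f]] by blast
  have F: "F x = A x - A (x - h)" for x
  proof -
    have "(\<integral>t. indicator {0..h} t *\<^sub>R f (x - t) \<partial>lborel) = - A (x - h) - - A (x - 0)"
    proof (rule integral_FTC_atLeastAtMost)
      show "continuous_on {0..h} (\<lambda>t. f (x - t))"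
        by (intro continuous_on_compose2[OF smooth1_continuous[OF f]] continuous_intros) auto
      show "((\<lambda>t. - A (x - t)) has_vector_derivative f (x - t)) (at t within {0..h})" for t
      proof -
        have "((\<lambda>t. x - t) has_real_derivative - 1) (at t within {0..h})"
          by (auto intro!: derivative_eq_intros)
        from DERIV_minus[OF DERIV_chain2[OF A this]] show ?thesis
          by (simp add: has_real_derivative_iff_has_vector_derivative)
      qed
    qed (use \<open>h > 0\<close> in auto)
    then show ?thesis by (simp add: F_def)
  qed
  have d: "(F has_real_derivative f x - f (x - h)) (at x)" for x
  proof -
    have "((\<lambda>x. x - h) has_real_derivative 1) (at x)"
      by (auto intro!: derivative_eq_intros)
    from DERIV_diff[OF A DERIV_chain2[OF A this]] 
    have "((\<lambda>x. A x - A (x - h)) has_real_derivative f x - f (x - h)) (at x)" by simp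
    moreover have "F = (\<lambda>x. A x - A (x - h))" by (rule ext) (rule F)
    ultimately show ?thesis by (simp only:)
  qed
  then show "deriv F x = f x - f (x - h)" by (rule DERIV_imp_deriv)
  \<comment> \<open>The increment is spelled with affine arguments to match
    \<open>Ck_affine\<close>. Smoothness of F then follows from that of its derivative.\<close>
  have "Ck n (\<lambda>x. f (1 * x + 0) + (- 1) * f (1 * x + (- h)))" for n
  proof -
    have "Ck n f" using f by (simp add: smooth1_def)
    from Ck_add[OF Ck_affine[OF this] Ck_mult[OF Ck_const Ck_affine[OF this]]] show ?thesis .
  qed
  then have "smooth1 (\<lambda>x. f x - f (x - h))" by (simp add: smooth1_def)
  from smooth1_antiderivative[OF d this] have "smooth1 F" .
  moreover have "F x = 0" if x: "\<bar>x\<bar> > M + h" for x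
  proof -
    have "indicator {0..h} t * f (x - t) = 0" for t
      using x M[of "x - t"] by (cases "t \<in> {0..h}") auto
    then show ?thesis unfolding F_def by (simp only: integral_zero)
  qed
  ultimately show "csmooth1 F" by (auto simp: csmooth1_def)
qed

section \<open>Tensor-product test functions\<close>

text \<open>Products suffice as test functions: bumps in each variable approximate indicators of
  boxes, and boxes generate the Borel sets. Smoothness in two variables is thereby reduced to
  one-variable calculus.\<close>

abbreviation tensor :: "(real \<Rightarrow> real) \<Rightarrow> (real \<Rightarrow> real) \<Rightarrow> real \<times> real \<Rightarrow> real" where
  "tensor \<alpha> \<beta> \<equiv> \<lambda>p. \<alpha> (fst p) * \<beta> (snd p)"

lemma pderiv2_tensor:
  assumes "smooth1 \<alpha>" "smooth1 \<beta>"
  shows "pderiv2 True (tensor \<alpha> \<beta>) = tensor \<alpha> (deriv \<beta>)"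
    and "pderiv2 False (tensor \<alpha> \<beta>) = tensor (deriv \<alpha>) \<beta>"
proof -
  have "deriv (\<lambda>t. \<alpha> x * \<beta> t) z = \<alpha> x * deriv \<beta> z" for x z
    by (intro DERIV_imp_deriv DERIV_cmult smooth1_deriv assms)
  then show "pderiv2 True (tensor \<alpha> \<beta>) = tensor \<alpha> (deriv \<beta>)"
    by (auto simp: pderiv2_def)
  have "deriv (\<lambda>t. \<alpha> t * \<beta> z) x = deriv \<alpha> x * \<beta> z" for x z
    by (intro DERIV_imp_deriv DERIV_cmult_right smooth1_deriv assms)
  then show "pderiv2 False (tensor \<alpha> \<beta>) = tensor (deriv \<alpha>) \<beta>"
    by (auto simp: pderiv2_def)
qed

text \<open>Each partial derivative acts on one factor only, so induction over the word
  \<open>ds\<close> keeps the product form. This settles at once all mixed derivatives that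
  \<open>smooth2\<close> demands.\<close>

lemma pderivs2_tensor:
  assumes "smooth1 \<alpha>" "smooth1 \<beta>"
  shows "\<exists>\<alpha>' \<beta>'. smooth1 \<alpha>' \<and> smooth1 \<beta>' \<and> pderivs2 ds (tensor \<alpha> \<beta>) = tensor \<alpha>' \<beta>'"
proof (induction ds)
  case Nil
  show ?case using assms by (auto simp: pderivs2_def)
next
  case (Cons d ds)
  then obtain \<alpha>' \<beta>' where *: "smooth1 \<alpha>'" "smooth1 \<beta>'" "pderivs2 ds (tensor \<alpha> \<beta>) = tensor \<alpha>' \<beta>'"
    by blast
  have "pderivs2 (d # ds) (tensor \<alpha> \<beta>) = pderiv2 d (tensor \<alpha>' \<beta>')"
    using *(3) by (simp add: pderivs2_def)
  then show ?case
    using * pderiv2_tensor[OF *(1,2)] smooth1_deriv(2) by (cases d) auto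
qed

lemma continuous_tensor:
  assumes "smooth1 \<alpha>" "smooth1 \<beta>"
  shows "continuous_on UNIV (tensor \<alpha> \<beta>)"
  by (intro continuous_intros continuous_on_compose2[OF smooth1_continuous[OF assms(1)]]
      continuous_on_compose2[OF smooth1_continuous[OF assms(2)]]) auto

lemma tensor_measurable:
  "csmooth1 \<alpha> \<Longrightarrow> csmooth1 \<beta> \<Longrightarrow> tensor \<alpha> \<beta> \<in> borel_measurable borel"
  by (intro borel_measurable_continuous_onI continuous_tensor) (auto simp: csmooth1_def)

lemma smooth2_tensor:
  assumes "smooth1 \<alpha>" "smooth1 \<beta>"
  shows "smooth2 (tensor \<alpha> \<beta>)"
  unfolding smooth2_def
proof
  fix ds
  obtain \<alpha>' \<beta>' where *: "smooth1 \<alpha>'" "smooth1 \<beta>'" "pderivs2 ds (tensor \<alpha> \<beta>) = tensor \<alpha>' \<beta>'"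
    using pderivs2_tensor[OF assms] by blast
  have "continuous_on UNIV (tensor \<alpha>' \<beta>')"
    by (intro continuous_tensor *)
  moreover have "\<alpha>' differentiable at x" "\<beta>' differentiable at x" for x
    using smooth1_deriv(1)[OF *(1)] smooth1_deriv(1)[OF *(2)] real_differentiable_def by blast+
  then have "partial_exists d (tensor \<alpha>' \<beta>')" for d
    by (auto simp: partial_exists_def)
  ultimately show "continuous_on UNIV (pderivs2 ds (tensor \<alpha> \<beta>)) \<and>
      (\<forall>d. partial_exists d (pderivs2 ds (tensor \<alpha> \<beta>)))"
    using * by auto
qed

lemma bounded_support_tensor:
  assumes "csmooth1 \<alpha>" "csmooth1 \<beta>"
  shows "bounded {p. tensor \<alpha> \<beta> p \<noteq> 0}"
proof -
  obtain M N where MN: "\<And>x. \<bar>x\<bar> > M \<Longrightarrow> \<alpha> x = 0" "\<And>x. \<bar>x\<bar> > N \<Longrightarrow> \<beta> x = 0"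
    using assms by (auto simp: csmooth1_def)
  have "{p. tensor \<alpha> \<beta> p \<noteq> 0} \<subseteq> {-M..M} \<times> {-N..N}"
  proof (intro subsetI)
    fix p assume "p \<in> {p. tensor \<alpha> \<beta> p \<noteq> 0}"
    then have "\<alpha> (fst p) \<noteq> 0" "\<beta> (snd p) \<noteq> 0" by auto
    then have "\<bar>fst p\<bar> \<le> M" "\<bar>snd p\<bar> \<le> N" using MN by (meson not_le)+
    then show "p \<in> {-M..M} \<times> {-N..N}" by (cases p) auto
  qed
  then show ?thesis
    by (rule bounded_subset[rotated]) (intro bounded_Times bounded_closed_interval)
qed

lemma test_fun_tensor:
  assumes "csmooth1 \<alpha>" "csmooth1 \<beta>"
  shows "test_fun (tensor \<alpha> \<beta>)"
  using assms bounded_support_tensor[OF assms] smooth2_tensor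
  by (simp add: test_fun_def csmooth1_def)

text \<open>As \<open>exp (-1/t)\<close> tends to 1 at infinity, dilation alone makes these bumps converge to the
  indicator of \<open>(a, b)\<close>; no normalised cut-off function is needed.\<close>

definition bump :: "real \<Rightarrow> real \<Rightarrow> nat \<Rightarrow> real \<Rightarrow> real" where
  "bump a b n x = exp_inv [:1:] (real n * (x - a)) * exp_inv [:1:] (real n * (b - x))"

lemma exp_inv_1_bounds: "0 \<le> exp_inv [:1:] x" "exp_inv [:1:] x \<le> 1"
  by (auto simp: exp_inv_def)

lemma bump_bounds: "0 \<le> bump a b n x" "bump a b n x \<le> 1"
  using exp_inv_1_bounds by (auto simp: bump_def intro!: mult_nonneg_nonneg mult_le_one)

lemma bump_eq_0: "x \<notin> {a<..<b} \<Longrightarrow> bump a b n x = 0"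
  by (auto simp: bump_def exp_inv_def mult_less_0_iff zero_less_mult_iff)

lemma bump_csmooth1: "csmooth1 (bump a b n)"
proof -
  have "smooth1 (\<lambda>x. exp_inv [:1:] (real n * x + (- real n * a)) * exp_inv [:1:] ((- real n) * x + real n * b))"
    by (rule smooth1_mult[OF smooth1_affine[OF smooth1_exp_inv] smooth1_affine[OF smooth1_exp_inv]])
  also have "(\<lambda>x. exp_inv [:1:] (real n * x + (- real n * a)) * exp_inv [:1:] ((- real n) * x + real n * b)) = bump a b n"
    by (auto simp: bump_def fun_eq_iff algebra_simps)
  finally show ?thesis
    unfolding csmooth1_def
    by (intro conjI exI[of _ "\<bar>a\<bar> + \<bar>b\<bar>"] allI impI bump_eq_0) auto
qed

lemma exp_inv_1_tendsto: 
  assumes "x > 0"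
  shows "(\<lambda>n. exp_inv [:1:] (real n * x)) \<longlonglongrightarrow> 1"
proof -
  have "(\<lambda>n. exp (- (1 / x) * (1 / real n))) \<longlonglongrightarrow> exp (- (1 / x) * 0)"
    by (intro tendsto_intros lim_1_over_n)
  moreover have "eventually (\<lambda>n. exp (- (1 / x) * (1 / real n)) = exp_inv [:1:] (real n * x)) sequentially"
    using eventually_gt_at_top[of 0] by eventually_elim (use assms in \<open>auto simp: exp_inv_def\<close>)
  ultimately show ?thesis
    by (auto intro: Lim_transform_eventually)
qed

lemma bump_tendsto: "(\<lambda>n. bump a b n x) \<longlonglongrightarrow> indicator {a<..<b} x"
proof (cases "x \<in> {a<..<b}")
  case True
  then have "(\<lambda>n. bump a b n x) \<longlonglongrightarrow> 1 * 1"
    unfolding bump_def by (intro tendsto_mult exp_inv_1_tendsto) auto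
  with True show ?thesis by simp
qed (simp add: bump_eq_0)

section \<open>Locally integrable functions annihilated by all tensor products\<close>

definition loc_int :: "(real \<times> real \<Rightarrow> real) \<Rightarrow> bool" where
  "loc_int f \<longleftrightarrow> f \<in> borel_measurable borel \<and>
    (\<forall>\<psi>\<in>borel_measurable borel. bounded (range \<psi>) \<longrightarrow> bounded {p. \<psi> p \<noteq> 0} \<longrightarrow>
       integrable lborel (\<lambda>p. f p * \<psi> p))"

lemma loc_intD:
  assumes "loc_int f" "\<psi> \<in> borel_measurable borel" "\<And>p. \<bar>\<psi> p\<bar> \<le> B" "bounded {p. \<psi> p \<noteq> (0::real)}"
  shows "integrable lborel (\<lambda>p. f p * \<psi> p)"
proof -
  have "bounded (range \<psi>)" using assms(3) by (auto intro!: boundedI[of _ B])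
  with assms show ?thesis by (simp add: loc_int_def)
qed

text \<open>Dominated convergence: the products of bumps converge pointwise to the indicator of the
  open box and stay below it.\<close>

lemma loc_int_box_zero:
  assumes E: "loc_int E"
    and test: "\<And>\<alpha> \<beta>. csmooth1 \<alpha> \<Longrightarrow> csmooth1 \<beta> \<Longrightarrow> (\<integral>p. E p * tensor \<alpha> \<beta> p \<partial>lborel) = 0"
  shows "(\<integral>p. E p * indicator (box l u) p \<partial>lborel) = 0"
proof -
  let ?\<psi> = "\<lambda>n. tensor (bump (fst l) (fst u) n) (bump (snd l) (snd u) n)"
  have E_meas[measurable]: "E \<in> borel_measurable borel" using E by (simp add: loc_int_def)
  have ind: "indicator (box l u) p = (indicator {fst l<..<fst u} (fst p) * indicator {snd l<..<snd u} (snd p) :: real)" for p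
    by (cases l; cases u; cases p) (auto simp: indicator_def mem_box Basis_prod_def)
  have int: "integrable lborel (\<lambda>p. E p * indicator (box l u) p)"
  proof (rule loc_intD[OF E, of _ 1])
    show "bounded {p. indicator (box l u) p \<noteq> (0::real)}"
      by (rule bounded_subset[OF bounded_box[of l u]]) (auto simp: indicator_def)
  qed (auto simp: indicator_def)
  have [measurable]: "?\<psi> n \<in> borel_measurable borel" for n
    by (intro tensor_measurable bump_csmooth1)
  have "(\<lambda>n. \<integral>p. E p * ?\<psi> n p \<partial>lborel) \<longlonglongrightarrow> (\<integral>p. E p * indicator (box l u) p \<partial>lborel)"
  proof (rule integral_dominated_convergence[where w="\<lambda>p. norm (E p * indicator (box l u) p)"])
    show "AE p in lborel. (\<lambda>n. E p * ?\<psi> n p) \<longlonglongrightarrow> E p * indicator (box l u) p"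
      unfolding ind by (intro AE_I2 tendsto_intros bump_tendsto)
    show "AE p in lborel. norm (E p * ?\<psi> n p) \<le> norm (E p * indicator (box l u) p)" for n
    proof (rule AE_I2)
      fix p
      have "\<bar>?\<psi> n p\<bar> \<le> indicator (box l u) p"
        unfolding ind using bump_bounds bump_eq_0
        by (auto simp: indicator_def abs_mult intro!: mult_le_one)
      then show "norm (E p * ?\<psi> n p) \<le> norm (E p * indicator (box l u) p)"
        by (simp add: abs_mult mult_left_mono)
    qed
  qed (use int in auto)
  moreover have "(\<integral>p. E p * ?\<psi> n p \<partial>lborel) = 0" for n
    by (rule test) (rule bump_csmooth1)+
  ultimately show ?thesis
    by (simp add: LIMSEQ_const_iff)
qed

lemma box_Int_is_box: "\<exists>l u. box a b \<inter> box c d = box l u"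
  for a b c d :: "'a::euclidean_space"
  using box_Int_box[of a b c d] by blast

text \<open>\<open>ennreal\<close> cuts negative values to 0, so \<open>?P\<close> and
  \<open>?N\<close> have the positive and the negative part of E as densities. They agree on open
  boxes, an intersection-stable generator with an exhaustion of finite measure. Hence the measures
  agree, the two parts of E agree almost everywhere, and both are 0 there.\<close>

lemma AE_zero_if_box_zero:
  fixes E :: "'a::euclidean_space \<Rightarrow> real"
  assumes int: "integrable lborel E" and zero: "\<And>l u. (\<integral>p. E p * indicator (box l u) p \<partial>lborel) = 0"
  shows "AE p in lborel. E p = 0"
proof -
  let ?P = "density lborel (\<lambda>p. ennreal (E p))" and ?N = "density lborel (\<lambda>p. ennreal (- E p))"
  have [measurable]: "E \<in> borel_measurable borel" using int by auto
  have fin: "(\<integral>\<^sup>+p. ennreal (\<bar>E p\<bar>) \<partial>lborel) < \<infinity>"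
    using int by (simp add: integrable_iff_bounded)
  have eq: "emeasure ?P (box l u) = emeasure ?N (box l u)" for l u
  proof -
    have i: "integrable lborel (\<lambda>p. E p * indicator (box l u) p)"
      using integrable_mult_indicator[OF _ int, of "box l u"] by (simp add: mult.commute)
    have "enn2real (\<integral>\<^sup>+p. ennreal (E p * indicator (box l u) p) \<partial>lborel) =
        enn2real (\<integral>\<^sup>+p. ennreal (- (E p * indicator (box l u) p)) \<partial>lborel)"
      using real_lebesgue_integral_def[OF i] zero[of l u] by simp
    \<comment> \<open>\<open>enn2real\<close> sends infinity to 0, so both integrals must be finite
      before it can be removed.\<close>
    moreover have "(\<integral>\<^sup>+p. ennreal (E p * indicator (box l u) p) \<partial>lborel) < \<infinity>"
      "(\<integral>\<^sup>+p. ennreal (- (E p * indicator (box l u) p)) \<partial>lborel) < \<infinity>"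
      using i by (auto simp: real_integrable_def less_top)
    ultimately have "(\<integral>\<^sup>+p. ennreal (E p * indicator (box l u) p) \<partial>lborel) =
        (\<integral>\<^sup>+p. ennreal (- (E p * indicator (box l u) p)) \<partial>lborel)"
      using ennreal_enn2real unfolding infinity_ennreal_def by metis
    moreover have "ennreal (E p) * indicator (box l u) p = ennreal (E p * indicator (box l u) p)"
      "ennreal (- E p) * indicator (box l u) p = ennreal (- (E p * indicator (box l u) p))" for p
      by (auto simp: indicator_def)
    ultimately show ?thesis
      by (simp add: emeasure_density)
  qed
  have "?P = ?N"
  proof (rule measure_eqI_generator_eq[where E="range (\<lambda>(a, b). box a b)" and \<Omega>=UNIV
        and A="\<lambda>n. box (- real n *\<^sub>R One) (real n *\<^sub>R One)"])
    show "Int_stable (range (\<lambda>(a, b). box a b :: 'a set))"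
      using box_Int_is_box[where 'a='a] by (force simp: Int_stable_def image_iff)
    show "(\<Union>n. box (- real n *\<^sub>R One) (real n *\<^sub>R One)) = (UNIV :: 'a set)"
      using UN_box_eq_UNIV by simp
    show "emeasure ?P (box (- real n *\<^sub>R One) (real n *\<^sub>R One)) \<noteq> \<infinity>" for n
    proof -
      have "emeasure ?P (box (- real n *\<^sub>R One) (real n *\<^sub>R One)) \<le> (\<integral>\<^sup>+p. ennreal (\<bar>E p\<bar>) \<partial>lborel)"
        by (auto simp: emeasure_density indicator_def intro!: nn_integral_mono ennreal_leI)
      with fin show ?thesis by (auto simp: less_top[symmetric] top_unique)
    qed
    show "sets ?P = sigma_sets UNIV (range (\<lambda>(a, b). box a b))"
      "sets ?N = sigma_sets UNIV (range (\<lambda>(a, b). box a b))"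
      by (simp_all add: borel_eq_box)
  qed (use eq in auto)
  then have "AE p in lborel. ennreal (E p) = ennreal (- E p)"
    by (intro sigma_finite_measure.density_unique[OF sigma_finite_lborel]) auto
  then show ?thesis
  proof eventually_elim
    case (elim p)
    then show ?case
      by (cases "E p \<ge> 0") (auto simp: ennreal_neg ennreal_eq_0_iff)
  qed
qed

text \<open>The fundamental lemma of the calculus of variations. E is only locally integrable, so it
  is first cut off to a box; the product of two box indicators is a box indicator, and countably
  many boxes cover the plane.\<close>

lemma loc_int_AE_zero:
  assumes E: "loc_int E"
    and test: "\<And>\<alpha> \<beta>. csmooth1 \<alpha> \<Longrightarrow> csmooth1 \<beta> \<Longrightarrow> (\<integral>p. E p * tensor \<alpha> \<beta> p \<partial>lborel) = 0"
  shows "AE p in lborel. E p = 0"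
proof -
  let ?B = "\<lambda>n::nat. box (- real n *\<^sub>R One) (real n *\<^sub>R One) :: (real \<times> real) set"
  have "AE p in lborel. E p * indicator (?B n) p = 0" for n
  proof (rule AE_zero_if_box_zero)
    show "integrable lborel (\<lambda>p. E p * indicator (?B n) p)"
    proof (rule loc_intD[OF E, of _ 1])
      show "bounded {p. indicator (?B n) p \<noteq> (0::real)}"
        by (rule bounded_subset[OF bounded_box]) (auto simp: indicator_def)
    qed (auto simp: indicator_def)
    show "(\<integral>p. E p * indicator (?B n) p * indicator (box l u) p \<partial>lborel) = 0" for l u
    proof -
      obtain l' u' where *: "?B n \<inter> box l u = box l' u'"
        using box_Int_is_box by blast
      have "indicator (?B n) p * indicator (box l u) p = (indicator (box l' u') p :: real)" for p
        unfolding *[symmetric] by (simp add: indicator_inter_arith)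
      then have "E p * indicator (?B n) p * indicator (box l u) p = E p * indicator (box l' u') p" for p
        by (simp only: mult.assoc)
      then have "(\<integral>p. E p * indicator (?B n) p * indicator (box l u) p \<partial>lborel) =
          (\<integral>p. E p * indicator (box l' u') p \<partial>lborel)"
        by (intro Bochner_Integration.integral_cong) auto
      also have "\<dots> = 0"
        using test by (rule loc_int_box_zero[OF E])
      finally show ?thesis .
    qed
  qed
  then have "AE p in lborel. \<forall>n. E p * indicator (?B n) p = 0"
    unfolding AE_all_countable by blast
  then show ?thesis
  proof eventually_elim
    case (elim p)
    have "(\<Union>n. ?B n) = UNIV" using UN_box_eq_UNIV by simp
    then have "p \<in> (\<Union>n. ?B n)" by (simp only: UNIV_I)
    then obtain n where "p \<in> ?B n" by (elim UN_E)
    then have "indicator (?B n) p = (1::real)" by (rule indicator_simps)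
    then show ?case using elim[rule_format, of n] by simp
  qed
qed

section \<open>Local integrability and shifts\<close>

lemma nn_integral_shift:
  fixes c :: "'a::euclidean_space"
  assumes [measurable]: "f \<in> borel_measurable borel"
  shows "(\<integral>\<^sup>+p. f (p + c) \<partial>lborel) = (\<integral>\<^sup>+p. f p \<partial>lborel)"
  by (subst (2) lborel_distr_plus[of c, symmetric]) (simp add: nn_integral_distr add.commute)

lemma integrable_shift:
  fixes c :: "'a::euclidean_space" and f :: "'a \<Rightarrow> real"
  assumes "integrable lborel f"
  shows "integrable lborel (\<lambda>p. f (p + c))"
proof -
  have [measurable]: "f \<in> borel_measurable borel" using assms by auto
  show ?thesis
    using assms nn_integral_shift[of "\<lambda>p. ennreal (norm (f p))" c] by (simp add: integrable_iff_bounded)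
qed

lemma integral_shift:
  fixes c :: "'a::euclidean_space" and f :: "'a \<Rightarrow> real"
  assumes [measurable]: "f \<in> borel_measurable borel"
  shows "(\<integral>p. f (p + c) \<partial>lborel) = (\<integral>p. f p \<partial>lborel)"
  by (subst (2) lborel_distr_plus[of c, symmetric]) (simp add: integral_distr add.commute)

lemma bounded_support_bounds:
  fixes \<psi> :: "'a::euclidean_space \<Rightarrow> real"
  assumes "bounded (range \<psi>)" "bounded {p. \<psi> p \<noteq> 0}"
  obtains B S where "\<And>p. \<bar>\<psi> p\<bar> \<le> B" "{p. \<psi> p \<noteq> 0} \<subseteq> cbox (-S) S"
proof -
  obtain B where "\<And>p. \<bar>\<psi> p\<bar> \<le> B"
    using assms(1) unfolding bounded_iff by auto
  moreover obtain S where "{p. \<psi> p \<noteq> 0} \<subseteq> cbox (-S) S"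
    using bounded_subset_cbox_symmetric[OF assms(2)] by blast
  ultimately show thesis by (rule that)
qed

text \<open>Meant for the weight \<open>snd\<close>: z \<phi> need not be square integrable, but on
  the bounded support of \<psi> the weight is at most D in modulus, and |w f \<psi>| \<le> f^2 + (D
  B)^2.\<close>

lemma L2_loc_int_weight:
  fixes w :: "real \<times> real \<Rightarrow> real"
  assumes f: "L2 f" and w: "continuous_on UNIV w"
  shows "loc_int (\<lambda>p. w p * f p)"
  unfolding loc_int_def
proof (intro conjI ballI impI)
  have [measurable]: "f \<in> borel_measurable borel" and f2: "integrable lborel (\<lambda>p. (f p)\<^sup>2)"
    using f by (auto simp: L2_def)
  have [measurable]: "w \<in> borel_measurable borel" by (rule borel_measurable_continuous_onI[OF w])
  show "(\<lambda>p. w p * f p) \<in> borel_measurable borel" by measurable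
  fix \<psi> :: "real \<times> real \<Rightarrow> real"
  assume [measurable]: "\<psi> \<in> borel_measurable borel" and "bounded (range \<psi>)" and "bounded {p. \<psi> p \<noteq> 0}"
  then obtain B S where B: "\<And>p. \<bar>\<psi> p\<bar> \<le> B" and S: "{p. \<psi> p \<noteq> 0} \<subseteq> cbox (-S) S"
    using bounded_support_bounds by blast
  have "compact (w ` cbox (-S) S)"
    by (rule compact_continuous_image[OF continuous_on_subset[OF w]]) auto
  then have "bounded (w ` cbox (-S) S)" by (rule compact_imp_bounded)
  then obtain D where D: "\<And>p. p \<in> cbox (-S) S \<Longrightarrow> \<bar>w p\<bar> \<le> D"
    unfolding bounded_iff by auto
  show "integrable lborel (\<lambda>p. w p * f p * \<psi> p)"
  proof (rule Bochner_Integration.integrable_bound)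
    show "integrable lborel (\<lambda>p. (f p)\<^sup>2 + (D * B)\<^sup>2 * indicator (cbox (-S) S) p)"
      by (intro Bochner_Integration.integrable_add f2 integrable_mult_right integrable_real_indicator)
         (auto simp: emeasure_lborel_cbox_eq)
    show "AE p in lborel. norm (w p * f p * \<psi> p) \<le> norm ((f p)\<^sup>2 + (D * B)\<^sup>2 * indicator (cbox (-S) S) p)"
    proof (rule AE_I2)
      fix p
      show "norm (w p * f p * \<psi> p) \<le> norm ((f p)\<^sup>2 + (D * B)\<^sup>2 * indicator (cbox (-S) S) p)"
      proof (cases "p \<in> cbox (-S) S")
        case True
        have "\<bar>w p * \<psi> p\<bar> \<le> D * B"
          unfolding abs_mult using D[OF True] B[of p] by (intro mult_mono) auto
        then have "\<bar>w p * \<psi> p\<bar> * \<bar>f p\<bar> \<le> D * B * \<bar>f p\<bar>"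
          by (intro mult_right_mono) auto
        also have "\<dots> \<le> (f p)\<^sup>2 + (D * B)\<^sup>2"
        proof -
          have "0 \<le> D * B * \<bar>f p\<bar>" using D[OF True] B[of p] by simp
          moreover have "2 * (D * B * \<bar>f p\<bar>) \<le> (f p)\<^sup>2 + (D * B)\<^sup>2"
            using sum_squares_bound[of "\<bar>f p\<bar>" "D * B"] by (simp add: mult_ac)
          ultimately show ?thesis by linarith
        qed
        finally show ?thesis using True by (simp add: abs_mult mult_ac)
      next
        case False
        then have "\<psi> p = 0" using S by auto
        then show ?thesis by simp
      qed
    qed
  qed measurable
qed

lemma L2_loc_int: "L2 f \<Longrightarrow> loc_int f"
  using L2_loc_int_weight[of f "\<lambda>_. 1"] by simp

text \<open>The bound |a b| \<le> a^2 + b^2 and translation invariance give a total mass of at most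
  the length of \<open>{0..h}\<close> times the sum of the two squared norms. This licenses Fubini
  for segment integrals; the two independent directions serve both sides of the duality
  below.\<close>

lemma L2_shift_product_integrable:
  fixes f g :: "'a::euclidean_space \<Rightarrow> real"
  assumes [measurable]: "f \<in> borel_measurable borel" "g \<in> borel_measurable borel"
    and f2: "integrable lborel (\<lambda>p. (f p)\<^sup>2)" and g2: "integrable lborel (\<lambda>p. (g p)\<^sup>2)"
  shows "integrable (lborel \<Otimes>\<^sub>M lborel) (\<lambda>(t, p). indicator {0..h::real} t * (f (p + t *\<^sub>R e) * g (p + t *\<^sub>R e')))"
  unfolding integrable_iff_bounded
proof
  let ?F = "\<integral>\<^sup>+p. ennreal ((f p)\<^sup>2) \<partial>lborel" and ?G = "\<integral>\<^sup>+p. ennreal ((g p)\<^sup>2) \<partial>lborel"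
  have fin: "?F < \<infinity>" "?G < \<infinity>" using f2 g2 by (auto simp: integrable_iff_bounded)
  show "(\<lambda>(t, p). indicator {0..h::real} t * (f (p + t *\<^sub>R e) * g (p + t *\<^sub>R e'))) \<in> borel_measurable (lborel \<Otimes>\<^sub>M lborel)"
    by measurable
  have "(\<integral>\<^sup>+q. ennreal (norm (case q of (t, p) \<Rightarrow> indicator {0..h} t * (f (p + t *\<^sub>R e) * g (p + t *\<^sub>R e')))) \<partial>(lborel \<Otimes>\<^sub>M lborel))
    \<le> (\<integral>\<^sup>+q. (case q of (t, p) \<Rightarrow> indicator {0..h} t * (ennreal ((f (p + t *\<^sub>R e))\<^sup>2) + ennreal ((g (p + t *\<^sub>R e'))\<^sup>2))) \<partial>(lborel \<Otimes>\<^sub>M lborel))"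
  proof (intro nn_integral_mono)
    fix q :: "real \<times> 'a"
    obtain t p where q: "q = (t, p)" by force
    let ?a = "f (p + t *\<^sub>R e)" and ?b = "g (p + t *\<^sub>R e')"
    have "\<bar>?a * ?b\<bar> \<le> ?a\<^sup>2 + ?b\<^sup>2"
    proof -
      have "2 * (\<bar>?a\<bar> * \<bar>?b\<bar>) \<le> ?a\<^sup>2 + ?b\<^sup>2" using sum_squares_bound[of "\<bar>?a\<bar>" "\<bar>?b\<bar>"] by simp
      moreover have "0 \<le> \<bar>?a\<bar> * \<bar>?b\<bar>" by simp
      ultimately show ?thesis unfolding abs_mult by linarith
    qed
    then show "ennreal (norm (case q of (t, p) \<Rightarrow> indicator {0..h} t * (f (p + t *\<^sub>R e) * g (p + t *\<^sub>R e'))))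
      \<le> (case q of (t, p) \<Rightarrow> indicator {0..h} t * (ennreal ((f (p + t *\<^sub>R e))\<^sup>2) + ennreal ((g (p + t *\<^sub>R e'))\<^sup>2)))"
      by (cases "t \<in> {0..h}") (auto simp: q ennreal_plus[symmetric] simp del: ennreal_plus intro!: ennreal_leI)
  qed
  also have "\<dots> = (\<integral>\<^sup>+t. \<integral>\<^sup>+p. indicator {0..h} t * (ennreal ((f (p + t *\<^sub>R e))\<^sup>2) + ennreal ((g (p + t *\<^sub>R e'))\<^sup>2)) \<partial>lborel \<partial>lborel)"
    by (subst lborel.nn_integral_fst[symmetric]) auto
  also have "\<dots> = (\<integral>\<^sup>+t. indicator {0..h} t * (?F + ?G) \<partial>lborel)"
    by (intro nn_integral_cong)
       (simp add: nn_integral_cmult nn_integral_add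
         nn_integral_shift[of "\<lambda>p. ennreal ((f p)\<^sup>2)"] nn_integral_shift[of "\<lambda>p. ennreal ((g p)\<^sup>2)"])
  also have "\<dots> = emeasure lborel {0..h} * (?F + ?G)"
    by (subst nn_integral_multc) auto
  also have "\<dots> < \<infinity>"
    using fin by (auto simp: ennreal_mult_less_top emeasure_lborel_Icc_eq)
  finally show "(\<integral>\<^sup>+q. ennreal (norm (case q of (t, p) \<Rightarrow> indicator {0..h} t * (f (p + t *\<^sub>R e) * g (p + t *\<^sub>R e')))) \<partial>(lborel \<Otimes>\<^sub>M lborel)) < \<infinity>" .
qed

lemma bounded_support_square_integrable:
  fixes \<psi> :: "'a::euclidean_space \<Rightarrow> real"
  assumes [measurable]: "\<psi> \<in> borel_measurable borel" and "bounded (range \<psi>)" and "bounded {p. \<psi> p \<noteq> 0}"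
  shows "integrable lborel (\<lambda>p. (\<psi> p)\<^sup>2)"
proof -
  obtain B S where B: "\<And>p. \<bar>\<psi> p\<bar> \<le> B" and S: "{p. \<psi> p \<noteq> 0} \<subseteq> cbox (-S) S"
    using bounded_support_bounds assms(2,3) by blast
  show ?thesis
  proof (rule Bochner_Integration.integrable_bound)
    show "integrable lborel (\<lambda>p. B\<^sup>2 * indicator (cbox (-S) S) p)"
      by (intro integrable_mult_right integrable_real_indicator) (auto simp: emeasure_lborel_cbox_eq)
    have "norm ((\<psi> p)\<^sup>2) \<le> norm (B\<^sup>2 * indicator (cbox (-S) S) p)" for p
      using B[of p] S by (cases "\<psi> p = 0") (auto simp: abs_le_square_iff[symmetric] subset_iff)
    then show "AE p in lborel. norm ((\<psi> p)\<^sup>2) \<le> norm (B\<^sup>2 * indicator (cbox (-S) S) p)"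
      by simp
  qed measurable
qed

section \<open>Weak derivatives as increments along segments\<close>

lemma loc_int_shift:
  assumes U: "loc_int U"
  shows "loc_int (\<lambda>p. U (p + c))"
  unfolding loc_int_def
proof (intro conjI ballI impI)
  have [measurable]: "U \<in> borel_measurable borel" using U by (simp add: loc_int_def)
  show "(\<lambda>p. U (p + c)) \<in> borel_measurable borel" by measurable
  fix \<psi> :: "real \<times> real \<Rightarrow> real"
  assume [measurable]: "\<psi> \<in> borel_measurable borel" and b: "bounded (range \<psi>)" and s: "bounded {p. \<psi> p \<noteq> 0}"
  have "integrable lborel (\<lambda>p. U p * \<psi> (p - c))"
  proof -
    have "bounded (range (\<lambda>p. \<psi> (p - c)))"
      by (rule bounded_subset[OF b]) auto
    moreover have "bounded {p. \<psi> (p - c) \<noteq> 0}"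
    proof -
      have "{p. \<psi> (p - c) \<noteq> 0} \<subseteq> (\<lambda>p. c + p) ` {p. \<psi> p \<noteq> 0}"
      proof
        fix p assume "p \<in> {p. \<psi> (p - c) \<noteq> 0}"
        then show "p \<in> (\<lambda>p. c + p) ` {p. \<psi> p \<noteq> 0}"
          by (intro image_eqI[of _ _ "p - c"]) auto
      qed
      then show ?thesis using bounded_translation[OF s] bounded_subset by blast
    qed
    ultimately show ?thesis using U by (simp add: loc_int_def)
  qed
  from integrable_shift[OF this, of c] show "integrable lborel (\<lambda>p. U (p + c) * \<psi> p)" by simp
qed

lemma loc_int_diff:
  assumes "loc_int f" "loc_int g"
  shows "loc_int (\<lambda>p. f p - g p)"
  using assms by (auto simp: loc_int_def left_diff_distrib)

lemma L2_bounded_support: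
  "\<psi> \<in> borel_measurable borel \<Longrightarrow> bounded (range \<psi>) \<Longrightarrow> bounded {p. \<psi> p \<noteq> 0} \<Longrightarrow> L2 \<psi>"
  by (simp add: L2_def bounded_support_square_integrable)

lemma L2_tensor:
  assumes "csmooth1 \<alpha>" "csmooth1 \<beta>"
  shows "L2 (tensor \<alpha> \<beta>)" "bounded (range (tensor \<alpha> \<beta>))"
proof -
  obtain A B where A: "\<And>x. \<bar>\<alpha> x\<bar> \<le> A" and B: "\<And>x. \<bar>\<beta> x\<bar> \<le> B"
    using csmooth1_bounded assms by metis
  have "\<bar>tensor \<alpha> \<beta> p\<bar> \<le> A * B" for p
    unfolding abs_mult using A B by (intro mult_mono) (auto intro: order_trans[OF abs_ge_zero])
  then show "bounded (range (tensor \<alpha> \<beta>))" by (auto intro!: boundedI[of _ "A * B"])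
  then show "L2 (tensor \<alpha> \<beta>)"
    using assms by (intro L2_bounded_support tensor_measurable bounded_support_tensor)
qed

text \<open>If f is the derivative of u in direction e, this is the increment u(p + h e) - u(p). As
  a Bochner integral it is 0 at points where f is not integrable along the segment.\<close>

definition seg_integral :: "real \<Rightarrow> 'a::real_vector \<Rightarrow> ('a \<Rightarrow> real) \<Rightarrow> 'a \<Rightarrow> real" where
  "seg_integral h e f p = (\<integral>t. indicator {0..h} t * f (p + t *\<^sub>R e) \<partial>lborel)"

text \<open>Fubini, and for each fixed t a translation by t e: integration along e has integration
  along -e as its adjoint.\<close>

lemma seg_integral_duality:
  assumes f: "L2 f" and g: "L2 g"
  shows "integrable lborel (\<lambda>p. seg_integral h e f p * g p)"
    and "(\<integral>p. seg_integral h e f p * g p \<partial>lborel) = (\<integral>p. f p * seg_integral h (- e) g p \<partial>lborel)"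
proof -
  have [measurable]: "f \<in> borel_measurable borel" "g \<in> borel_measurable borel" 
    and f2: "integrable lborel (\<lambda>p. (f p)\<^sup>2)" and g2: "integrable lborel (\<lambda>p. (g p)\<^sup>2)"
    using f g by (auto simp: L2_def)
  \<comment> \<open>The trivial shifts by \<open>t *\<^sub>R 0\<close> bring both kernels into the
    form of \<open>L2_shift_product_integrable\<close>.\<close>
  let ?K = "\<lambda>t p. indicator {0..h} t * (f (p + t *\<^sub>R e) * g (p + t *\<^sub>R 0))"
  let ?L = "\<lambda>t p. indicator {0..h} t * (f (p + t *\<^sub>R 0) * g (p + t *\<^sub>R (-e)))"
  have K: "integrable (lborel \<Otimes>\<^sub>M lborel) (case_prod ?K)" and L: "integrable (lborel \<Otimes>\<^sub>M lborel) (case_prod ?L)"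
    by (intro L2_shift_product_integrable f2 g2; measurable)+
  have eK: "seg_integral h e f p * g p = (\<integral>t. ?K t p \<partial>lborel)" for p
    unfolding seg_integral_def by (simp flip: integral_mult_left_zero add: mult.assoc)
  have eL: "f p * seg_integral h (-e) g p = (\<integral>t. ?L t p \<partial>lborel)" for p
    unfolding seg_integral_def by (simp flip: integral_mult_right_zero add: mult_ac)
  show "integrable lborel (\<lambda>p. seg_integral h e f p * g p)"
    unfolding eK by (rule lborel_pair.integrable_snd[OF K])
  have "(\<integral>p. ?K t p \<partial>lborel) = (\<integral>p. ?L t p \<partial>lborel)" for t
    using integral_shift[of "\<lambda>p. f p * g (p - t *\<^sub>R e)" "t *\<^sub>R e"] by simp
  then show "(\<integral>p. seg_integral h e f p * g p \<partial>lborel) = (\<integral>p. f p * seg_integral h (- e) g p \<partial>lborel)"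
    unfolding eK eL lborel_pair.Fubini_integral[OF K] lborel_pair.Fubini_integral[OF L] by (simp only:)
qed

lemma seg_integral_measurable [measurable]:
  fixes f :: "'a::euclidean_space \<Rightarrow> real"
  assumes [measurable]: "f \<in> borel_measurable borel"
  shows "seg_integral h e f \<in> borel_measurable borel"
  unfolding seg_integral_def by measurable

lemma loc_int_seg_integral: "L2 f \<Longrightarrow> loc_int (seg_integral h e f)"
  unfolding loc_int_def using seg_integral_duality(1) seg_integral_measurable L2_bounded_support
  by (auto simp: L2_def)

text \<open>f is paired with the indicator of a large box, which is square integrable and evaluated
  at the unshifted point p. Fubini gives integrability in t for almost every p of that box, and
  countably many boxes exhaust the plane.\<close>

lemma AE_shift_integrable:
  assumes f: "L2 f"
  shows "AE p in lborel. integrable lborel (\<lambda>t. indicator {0..h} t * f (p + t *\<^sub>R e))"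
proof -
  let ?B = "\<lambda>n::nat. box (- real n *\<^sub>R One) (real n *\<^sub>R One) :: (real \<times> real) set"
  have [measurable]: "f \<in> borel_measurable borel" and f2: "integrable lborel (\<lambda>p. (f p)\<^sup>2)"
    using f by (auto simp: L2_def)
  have "AE p in lborel. integrable lborel (\<lambda>t. indicator {0..h} t * (f (p + t *\<^sub>R e) * indicator (?B n) (p + t *\<^sub>R 0)))" for n
  proof (rule lborel_pair.AE_integrable_snd[OF L2_shift_product_integrable])
    show "integrable lborel (\<lambda>p. (indicator (?B n) p :: real)\<^sup>2)"
    proof (rule bounded_support_square_integrable)
      show "bounded {p. indicator (?B n) p \<noteq> (0::real)}"
        by (rule bounded_subset[OF bounded_box]) (auto simp: indicator_def)
    qed (auto simp: indicator_def intro!: boundedI[of _ 1])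
  qed (use f2 in auto)
  then have "AE p in lborel. \<forall>n. integrable lborel (\<lambda>t. indicator {0..h} t * (f (p + t *\<^sub>R e) * indicator (?B n) (p + t *\<^sub>R 0)))"
    unfolding AE_all_countable by blast
  then show ?thesis
  proof eventually_elim
    case (elim p)
    have "(\<Union>n. ?B n) = UNIV" using UN_box_eq_UNIV by simp
    then have "p \<in> (\<Union>n. ?B n)" by (simp only: UNIV_I)
    then obtain n where "p \<in> ?B n" by (elim UN_E)
    then have "indicator (?B n) p = (1::real)" by (rule indicator_simps)
    then show ?case using elim[rule_format, of n] by simp
  qed
qed

text \<open>The hypothesis \<open>weak\<close> is the integrated form of the statement that V is the
  derivative of U along e. Moving the shift and the segment integral onto the test function shows
  that the difference of the two sides annihilates every tensor product.\<close>

lemma AE_diff_eq_seg_integral: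
  assumes U: "loc_int U" and V: "L2 V"
    and weak: "\<And>\<alpha> \<beta>. csmooth1 \<alpha> \<Longrightarrow> csmooth1 \<beta> \<Longrightarrow>
      (\<integral>p. U p * (tensor \<alpha> \<beta> p - tensor \<alpha> \<beta> (p - h *\<^sub>R e)) \<partial>lborel) = - (\<integral>p. V p * seg_integral h (- e) (tensor \<alpha> \<beta>) p \<partial>lborel)"
  shows "AE p in lborel. U (p + h *\<^sub>R e) - U p = seg_integral h e V p"
proof -
  have [measurable]: "U \<in> borel_measurable borel" using U by (simp add: loc_int_def)
  have "AE p in lborel. (U (p + h *\<^sub>R e) - U p) - seg_integral h e V p = 0"
  proof (rule loc_int_AE_zero)
    show "loc_int (\<lambda>p. (U (p + h *\<^sub>R e) - U p) - seg_integral h e V p)"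
      by (intro loc_int_diff loc_int_shift loc_int_seg_integral U V)
    fix \<alpha> \<beta> assume ab: "csmooth1 \<alpha>" "csmooth1 \<beta>"
    let ?\<psi> = "tensor \<alpha> \<beta>"
    note t[measurable] = tensor_measurable[OF ab]
    have i1: "integrable lborel (\<lambda>p. U p * ?\<psi> p)" and i2: "integrable lborel (\<lambda>p. U (p + h *\<^sub>R e) * ?\<psi> p)"
      using U loc_int_shift[OF U] t L2_tensor(2)[OF ab] bounded_support_tensor[OF ab]
      by (auto simp: loc_int_def)
    have i3: "integrable lborel (\<lambda>p. U p * ?\<psi> (p - h *\<^sub>R e))"
      using integrable_shift[OF i2, of "- (h *\<^sub>R e)"] by simp
    have e: "(\<integral>p. U (p + h *\<^sub>R e) * ?\<psi> p \<partial>lborel) = (\<integral>p. U p * ?\<psi> (p - h *\<^sub>R e) \<partial>lborel)"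
    proof -
      have "(\<lambda>p. U p * ?\<psi> (p - h *\<^sub>R e)) \<in> borel_measurable borel"
        using borel_measurable_integrable[OF i3] by (simp only: measurable_lborel2)
      from integral_shift[OF this, of "h *\<^sub>R e"] show ?thesis by simp
    qed
    note d = seg_integral_duality[OF V L2_tensor(1)[OF ab], of h e]
    have "(\<integral>p. ((U (p + h *\<^sub>R e) - U p) - seg_integral h e V p) * ?\<psi> p \<partial>lborel)
      = (\<integral>p. (U (p + h *\<^sub>R e) * ?\<psi> p - U p * ?\<psi> p) - seg_integral h e V p * ?\<psi> p \<partial>lborel)"
      by (simp only: left_diff_distrib)
    also have "\<dots> = ((\<integral>p. U p * ?\<psi> (p - h *\<^sub>R e) \<partial>lborel) - (\<integral>p. U p * ?\<psi> p \<partial>lborel)) - (\<integral>p. V p * seg_integral h (- e) ?\<psi> p \<partial>lborel)"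
      using i1 i2 d e by simp
    also have "\<dots> = 0"
      using weak[OF ab] i1 i3 by (simp add: right_diff_distrib)
    finally show "(\<integral>p. ((U (p + h *\<^sub>R e) - U p) - seg_integral h e V p) * ?\<psi> p \<partial>lborel) = 0" .
  qed
  then show ?thesis by simp
qed

lemma seg_integral_tensor_1:
  "seg_integral h (- (1, 0)) (tensor \<alpha> \<beta>) = tensor (\<lambda>x. \<integral>t. indicator {0..h} t * \<alpha> (x - t) \<partial>lborel) \<beta>"
  unfolding seg_integral_def by (simp flip: integral_mult_left_zero add: mult.assoc fun_eq_iff)

lemma seg_integral_tensor_2:
  "seg_integral h (- (0, 1)) (tensor \<alpha> \<beta>) = tensor \<alpha> (\<lambda>z. \<integral>t. indicator {0..h} t * \<beta> (z - t) \<partial>lborel)"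
  unfolding seg_integral_def by (simp flip: integral_mult_right_zero add: mult_ac fun_eq_iff)

text \<open>The test function is the window integral of \<alpha> in x times \<beta>, whose
  x-derivative is the increment of the tensor product. The role of U is played by z \<phi>; a
  horizontal shift preserves z, so z factors out of the increment.\<close>

lemma weak_z_dx_AE_diff:
  assumes \<phi>: "L2 \<phi>" and g: "L2 g" and w: "weak_z_dx \<phi> g" and h: "h > 0"
  shows "AE p in lborel. snd p * (\<phi> (p + (h, 0)) - \<phi> p) = seg_integral h (1, 0) g p"
proof -
  have "AE p in lborel. snd (p + h *\<^sub>R (1, 0)) * \<phi> (p + h *\<^sub>R (1, 0)) - snd p * \<phi> p = seg_integral h (1, 0) g p"
  proof (rule AE_diff_eq_seg_integral[where U="\<lambda>p. snd p * \<phi> p"])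
    show "loc_int (\<lambda>p. snd p * \<phi> p)"
      by (intro L2_loc_int_weight \<phi> continuous_intros)
    fix \<alpha> \<beta> assume ab: "csmooth1 \<alpha>" "csmooth1 \<beta>"
    let ?A = "\<lambda>x. \<integral>t. indicator {0..h} t * \<alpha> (x - t) \<partial>lborel"
    have A: "csmooth1 ?A" "deriv ?A x = \<alpha> x - \<alpha> (x - h)" for x
      using csmooth1_window_integral[OF ab(1) h] by auto
    have "pderiv2 False (tensor ?A \<beta>) = tensor (deriv ?A) \<beta>"
      using A(1) ab(2) by (intro pderiv2_tensor) (auto simp: csmooth1_def)
    then have "pderiv2 False (tensor ?A \<beta>) p = tensor \<alpha> \<beta> p - tensor \<alpha> \<beta> (p - h *\<^sub>R (1, 0))" for p
      by (simp add: A(2) left_diff_distrib)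
    then show "(\<integral>p. snd p * \<phi> p * (tensor \<alpha> \<beta> p - tensor \<alpha> \<beta> (p - h *\<^sub>R (1, 0))) \<partial>lborel) =
        - (\<integral>p. g p * seg_integral h (- (1, 0)) (tensor \<alpha> \<beta>) p \<partial>lborel)"
      using w[unfolded weak_z_dx_def, rule_format, OF test_fun_tensor[OF A(1) ab(2)]]
      unfolding seg_integral_tensor_1 by (simp only: mult.left_commute mult.assoc)
  qed (rule g)
  then show ?thesis by (simp add: right_diff_distrib)
qed

text \<open>The same argument with the window integral in z. Only tensor products are tested, so the
  result serves both \<phi> and its z-derivative, for which the weak relation is derived on tensor
  products alone.\<close>

lemma tensor_weak_dz_AE_diff:
  assumes f: "L2 f" and g: "L2 g" and h: "h > 0"
    and w: "\<And>\<alpha> \<beta>. csmooth1 \<alpha> \<Longrightarrow> csmooth1 \<beta> \<Longrightarrow>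
      (\<integral>p. f p * tensor \<alpha> (deriv \<beta>) p \<partial>lborel) = - (\<integral>p. g p * tensor \<alpha> \<beta> p \<partial>lborel)"
  shows "AE p in lborel. f (p + (0, h)) - f p = seg_integral h (0, 1) g p"
proof -
  have "AE p in lborel. f (p + h *\<^sub>R (0, 1)) - f p = seg_integral h (0, 1) g p"
  proof (rule AE_diff_eq_seg_integral[OF L2_loc_int[OF f] g])
    fix \<alpha> \<beta> assume ab: "csmooth1 \<alpha>" "csmooth1 \<beta>"
    let ?B = "\<lambda>z. \<integral>t. indicator {0..h} t * \<beta> (z - t) \<partial>lborel"
    have B: "csmooth1 ?B" "deriv ?B x = \<beta> x - \<beta> (x - h)" for x
      using csmooth1_window_integral[OF ab(2) h] by auto
    have "tensor \<alpha> (deriv ?B) p = tensor \<alpha> \<beta> p - tensor \<alpha> \<beta> (p - h *\<^sub>R (0, 1))" for p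
      by (simp add: B(2) right_diff_distrib)
    then show "(\<integral>p. f p * (tensor \<alpha> \<beta> p - tensor \<alpha> \<beta> (p - h *\<^sub>R (0, 1))) \<partial>lborel) =
        - (\<integral>p. g p * seg_integral h (- (0, 1)) (tensor \<alpha> \<beta>) p \<partial>lborel)"
      using w[OF ab(1) B(1)] unfolding seg_integral_tensor_2 by (simp only:)
  qed
  then show ?thesis by simp
qed

lemma weak_dz_tensor:
  assumes w: "weak_dz \<phi> g" and ab: "csmooth1 \<alpha>" "csmooth1 \<beta>"
  shows "(\<integral>p. \<phi> p * tensor \<alpha> (deriv \<beta>) p \<partial>lborel) = - (\<integral>p. g p * tensor \<alpha> \<beta> p \<partial>lborel)"
proof -
  have "pderiv2 True (tensor \<alpha> \<beta>) = tensor \<alpha> (deriv \<beta>)"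
    using ab by (intro pderiv2_tensor) (auto simp: csmooth1_def)
  then show ?thesis
    using w[unfolded weak_dz_def, rule_format, OF test_fun_tensor[OF ab]] by (simp only:)
qed

text \<open>Tested with the z-derivative of \<beta>, \<open>weak_dz\<close> makes the pairing of g
  minus a pairing of \<phi> with the second derivative, which \<open>weak_dzz\<close> evaluates.
  Thus k is the weak z-derivative of g.\<close>

lemma weak_dzz_tensor:
  assumes w: "weak_dz \<phi> g" and w2: "weak_dzz \<phi> k" and ab: "csmooth1 \<alpha>" "csmooth1 \<beta>"
  shows "(\<integral>p. g p * tensor \<alpha> (deriv \<beta>) p \<partial>lborel) = - (\<integral>p. k p * tensor \<alpha> \<beta> p \<partial>lborel)"
proof -
  have "pderiv2 True (tensor \<alpha> \<beta>) = tensor \<alpha> (deriv \<beta>)"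
    using ab by (intro pderiv2_tensor) (auto simp: csmooth1_def)
  moreover have "pderiv2 True (tensor \<alpha> (deriv \<beta>)) = tensor \<alpha> (deriv (deriv \<beta>))"
    using ab csmooth1_deriv[OF ab(2)] by (intro pderiv2_tensor) (auto simp: csmooth1_def)
  ultimately have "(\<integral>p. \<phi> p * tensor \<alpha> (deriv (deriv \<beta>)) p \<partial>lborel) = (\<integral>p. k p * tensor \<alpha> \<beta> p \<partial>lborel)"
    using w2[unfolded weak_dzz_def, rule_format, OF test_fun_tensor[OF ab]] by (simp only:)
  then show ?thesis
    using weak_dz_tensor[OF w ab(1) csmooth1_deriv[OF ab(2)]] by linarith
qed

lemma weak_dz_AE_diff:
  assumes "L2 \<phi>" "L2 g" "weak_dz \<phi> g" "h > 0"
  shows "AE p in lborel. \<phi> (p + (0, h)) - \<phi> p = seg_integral h (0, 1) g p"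
  using assms weak_dz_tensor[OF assms(3)] by (intro tensor_weak_dz_AE_diff)

lemma weak_dzz_AE_diff:
  assumes "L2 g" "L2 k" "weak_dz \<phi> g" "weak_dzz \<phi> k" "h > 0"
  shows "AE p in lborel. g (p + (0, h)) - g p = seg_integral h (0, 1) k p"
  using assms weak_dzz_tensor[OF assms(3,4)] by (intro tensor_weak_dz_AE_diff)

section \<open>Weighted bounds for segment integrals\<close>

lemma AE_shift:
  fixes c :: "'a::euclidean_space"
  assumes "AE p in lborel. P p"
  shows "AE p in lborel. P (p + c)"
proof -
  have "AE p in distr lborel borel ((+) c). P p"
    using assms by (subst lborel_distr_plus)
  then have "AE p in lborel. P (c + p)"
    by (rule AE_distrD[rotated]) simp
  then show ?thesis by (simp add: add.commute)
qed

lemma snd_borel [measurable]: "snd \<in> borel_measurable (borel :: (real \<times> real) measure)"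
  by (intro borel_measurable_continuous_onI continuous_intros)

lemma nn_integral_pair:
  fixes f :: "real \<times> real \<Rightarrow> ennreal"
  assumes [measurable]: "f \<in> borel_measurable borel"
  shows "(\<integral>\<^sup>+p. f p \<partial>lborel) = (\<integral>\<^sup>+x. \<integral>\<^sup>+z. f (x, z) \<partial>lborel \<partial>lborel)"
  by (subst lborel_prod[symmetric], subst lborel.nn_integral_fst) (simp_all add: lborel_prod)

text \<open>Holds also for non-integrable u, whose Bochner integral is 0.\<close>

lemma integral_square_le:
  fixes u :: "'a \<Rightarrow> real"
  shows "ennreal ((\<integral>t. u t \<partial>M)\<^sup>2) \<le> (\<integral>\<^sup>+t. ennreal \<bar>u t\<bar> \<partial>M)\<^sup>2"
proof -
  have "ennreal \<bar>\<integral>t. u t \<partial>M\<bar> \<le> (\<integral>\<^sup>+t. ennreal \<bar>u t\<bar> \<partial>M)"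
    by (cases "integrable M u") (use integral_norm_bound_ennreal[of M u] in \<open>auto simp: not_integrable_integral_eq\<close>)
  then have "ennreal \<bar>\<integral>t. u t \<partial>M\<bar> ^ 2 \<le> (\<integral>\<^sup>+t. ennreal \<bar>u t\<bar> \<partial>M)\<^sup>2"
    by (intro power_mono) auto
  then show ?thesis by (simp add: ennreal_power)
qed

text \<open>Cauchy-Schwarz; the indicator is idempotent and is duplicated so that one copy can be
  the first factor, contributing h.\<close>

lemma seg_integral_square_le:
  fixes f :: "'a::euclidean_space \<Rightarrow> real"
  assumes [measurable]: "f \<in> borel_measurable borel" and h: "h \<ge> 0"
  shows "ennreal ((seg_integral h e f p)\<^sup>2) \<le> ennreal h * (\<integral>\<^sup>+t. indicator {0..h} t * ennreal ((f (p + t *\<^sub>R e))\<^sup>2) \<partial>lborel)"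
proof -
  have "ennreal ((seg_integral h e f p)\<^sup>2) \<le> (\<integral>\<^sup>+t. ennreal \<bar>indicator {0..h} t * f (p + t *\<^sub>R e)\<bar> \<partial>lborel)\<^sup>2"
    unfolding seg_integral_def by (rule integral_square_le)
  also have "(\<lambda>t. ennreal \<bar>indicator {0..h} t * f (p + t *\<^sub>R e)\<bar>) =
      (\<lambda>t. indicator {0..h} t * ennreal \<bar>indicator {0..h} t * f (p + t *\<^sub>R e)\<bar>)"
    by (auto simp: indicator_def fun_eq_iff)
  also have "(\<integral>\<^sup>+t. indicator {0..h} t * ennreal \<bar>indicator {0..h} t * f (p + t *\<^sub>R e)\<bar> \<partial>lborel)\<^sup>2 \<le>
     (\<integral>\<^sup>+t. (indicator {0..h} t)\<^sup>2 \<partial>lborel) * (\<integral>\<^sup>+t. (ennreal \<bar>indicator {0..h} t * f (p + t *\<^sub>R e)\<bar>)\<^sup>2 \<partial>lborel)"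
    by (rule Cauchy_Schwarz_nn_integral) measurable
  also have "(\<lambda>t. (indicator {0..h} t)\<^sup>2 :: ennreal) = indicator {0..h}"
    by (auto simp: indicator_def fun_eq_iff)
  also have "(\<lambda>t. (ennreal \<bar>indicator {0..h} t * f (p + t *\<^sub>R e)\<bar>)\<^sup>2) = (\<lambda>t. indicator {0..h} t * ennreal ((f (p + t *\<^sub>R e))\<^sup>2))"
    by (auto simp: indicator_def fun_eq_iff ennreal_power)
  finally show ?thesis using h by (simp add: emeasure_lborel_Icc)
qed

text \<open>One factor h comes from Cauchy-Schwarz, the other from integrating over t after Fubini
  and translation by t e. The condition on W and W' lets the weight follow the translation: W' = W
  for horizontal shifts, an enlarged strip for vertical ones.\<close>

lemma seg_integral_weighted_bound:
  fixes f :: "'a::euclidean_space \<Rightarrow> real"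
  assumes [measurable]: "f \<in> borel_measurable borel" "W \<in> borel_measurable borel" "W' \<in> borel_measurable borel"
    and h: "h \<ge> 0" and W: "\<And>p t. t \<in> {0..h} \<Longrightarrow> W p \<le> W' (p + t *\<^sub>R e)"
  shows "(\<integral>\<^sup>+p. W p * ennreal ((seg_integral h e f p)\<^sup>2) \<partial>lborel) \<le> ennreal (h\<^sup>2) * (\<integral>\<^sup>+p. W' p * ennreal ((f p)\<^sup>2) \<partial>lborel)"
proof -
  let ?I = "\<integral>\<^sup>+p. W' p * ennreal ((f p)\<^sup>2) \<partial>lborel"
  have "(\<integral>\<^sup>+p. W p * ennreal ((seg_integral h e f p)\<^sup>2) \<partial>lborel)
    \<le> (\<integral>\<^sup>+p. ennreal h * (\<integral>\<^sup>+t. W p * (indicator {0..h} t * ennreal ((f (p + t *\<^sub>R e))\<^sup>2)) \<partial>lborel) \<partial>lborel)"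
  proof (rule nn_integral_mono)
    fix p
    have "W p * ennreal ((seg_integral h e f p)\<^sup>2) \<le> W p * (ennreal h * (\<integral>\<^sup>+t. indicator {0..h} t * ennreal ((f (p + t *\<^sub>R e))\<^sup>2) \<partial>lborel))"
      by (intro mult_left_mono seg_integral_square_le h) auto
    also have "\<dots> = ennreal h * (\<integral>\<^sup>+t. W p * (indicator {0..h} t * ennreal ((f (p + t *\<^sub>R e))\<^sup>2)) \<partial>lborel)"
      by (subst nn_integral_cmult) (auto simp: mult_ac)
    finally show "W p * ennreal ((seg_integral h e f p)\<^sup>2) \<le> \<dots>" .
  qed
  also have "\<dots> = ennreal h * (\<integral>\<^sup>+t. \<integral>\<^sup>+p. W p * (indicator {0..h} t * ennreal ((f (p + t *\<^sub>R e))\<^sup>2)) \<partial>lborel \<partial>lborel)"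
    by (subst nn_integral_cmult, measurable, subst lborel_pair.Fubini', measurable)
  also have "\<dots> \<le> ennreal h * (\<integral>\<^sup>+t. indicator {0..h} t * ?I \<partial>lborel)"
  proof (intro mult_left_mono nn_integral_mono)
    fix t
    have "(\<integral>\<^sup>+p. W p * (indicator {0..h} t * ennreal ((f (p + t *\<^sub>R e))\<^sup>2)) \<partial>lborel)
      \<le> (\<integral>\<^sup>+p. indicator {0..h} t * (W' (p + t *\<^sub>R e) * ennreal ((f (p + t *\<^sub>R e))\<^sup>2)) \<partial>lborel)"
      by (intro nn_integral_mono, cases "t \<in> {0..h}") (auto intro!: mult_right_mono W)
    also have "\<dots> = indicator {0..h} t * ?I"
      using nn_integral_shift[of "\<lambda>p. W' p * ennreal ((f p)\<^sup>2)" "t *\<^sub>R e"] by (simp add: nn_integral_cmult)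
    finally show "(\<integral>\<^sup>+p. W p * (indicator {0..h} t * ennreal ((f (p + t *\<^sub>R e))\<^sup>2)) \<partial>lborel) \<le> indicator {0..h} t * ?I" .
  qed simp
  also have "\<dots> = ennreal (h\<^sup>2) * ?I"
    using h by (subst nn_integral_multc) (auto simp: emeasure_lborel_Icc power2_eq_square ennreal_mult mult.assoc)
  finally show ?thesis .
qed

section \<open>Integrals of powers on the line\<close>

lemma nn_integral_powr_from_0:
  assumes "a > -1" "c \<ge> 0"
  shows "(\<integral>\<^sup>+x. indicator {0..c} x * ennreal (x powr a) \<partial>lborel) = ennreal (c powr (a + 1) / (a + 1))"
proof -
  have "((\<lambda>x. indicator {0..c} x * x powr a) has_integral c powr (a + 1) / (a + 1)) UNIV"
    using has_integral_powr_from_0[OF assms]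
    by (subst (asm) has_integral_restrict_UNIV[symmetric])
       (auto simp: indicator_def of_bool_def if_distrib if_distribR cong: if_cong)
  from nn_integral_has_integral_lborel[OF _ _ this]
  have "(\<integral>\<^sup>+x. ennreal (indicator {0..c} x * x powr a) \<partial>lborel) = ennreal (c powr (a + 1) / (a + 1))"
    by simp
  then show ?thesis by (simp add: ennreal_mult' ennreal_indicator)
qed

lemma nn_integral_powr_to_inf:
  fixes a c :: real
  assumes "a < -1" "c > 0"
  shows "(\<integral>\<^sup>+x. indicator {c..} x * ennreal (x powr a) \<partial>lborel) = ennreal (- (c powr (a + 1)) / (a + 1))"
proof -
  have "((\<lambda>x. indicator {c..} x * x powr a) has_integral - (c powr (a + 1)) / (a + 1)) UNIV"
    using has_integral_powr_to_inf[OF assms]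
    by (subst (asm) has_integral_restrict_UNIV[symmetric])
       (auto simp: indicator_def of_bool_def if_distrib if_distribR cong: if_cong)
  from nn_integral_has_integral_lborel[OF _ _ this]
  have "(\<integral>\<^sup>+x. ennreal (indicator {c..} x * x powr a) \<partial>lborel) = ennreal (- (c powr (a + 1)) / (a + 1))"
    by simp
  then show ?thesis by (simp add: ennreal_mult' ennreal_indicator)
qed

lemma nn_integral_even:
  fixes f :: "real \<Rightarrow> ennreal"
  assumes [measurable]: "f \<in> borel_measurable borel" and even: "\<And>x. f (- x) = f x"
  shows "(\<integral>\<^sup>+x. f x \<partial>lborel) = 2 * (\<integral>\<^sup>+x. indicator {0..} x * f x \<partial>lborel)"
proof -
  \<comment> \<open>Both half-lines contain 0, so the identity is claimed only off this null
    set.\<close>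
  have "AE x in lborel. f x = indicator {0..} x * f x + indicator {..0} x * f x"
    using AE_lborel_singleton[of 0] by eventually_elim (auto simp: indicator_def)
  then have "(\<integral>\<^sup>+x. f x \<partial>lborel) = (\<integral>\<^sup>+x. indicator {0..} x * f x + indicator {..0} x * f x \<partial>lborel)"
    by (rule nn_integral_cong_AE)
  also have "\<dots> = (\<integral>\<^sup>+x. indicator {0..} x * f x \<partial>lborel) + (\<integral>\<^sup>+x. indicator {..0} x * f x \<partial>lborel)"
    by (rule nn_integral_add) measurable
  also have "(\<integral>\<^sup>+x. indicator {..0} x * f x \<partial>lborel) = (\<integral>\<^sup>+x. indicator {0..} x * f x \<partial>lborel)"
    by (subst nn_integral_real_affine[of _ "-1" 0]) (auto simp: even indicator_def intro!: nn_integral_cong)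
  finally show ?thesis by (simp add: mult_2)
qed

lemma nn_integral_abs_powr:
  assumes "a > -1" "c \<ge> 0"
  shows "(\<integral>\<^sup>+x. indicator {-c..c} x * ennreal (\<bar>x\<bar> powr a) \<partial>lborel) = ennreal (2 * (c powr (a + 1) / (a + 1)))"
proof -
  have "(\<integral>\<^sup>+x. indicator {-c..c} x * ennreal (\<bar>x\<bar> powr a) \<partial>lborel) =
     2 * (\<integral>\<^sup>+x. indicator {0..} x * (indicator {-c..c} x * ennreal (\<bar>x\<bar> powr a)) \<partial>lborel)"
    by (rule nn_integral_even) (auto simp: indicator_def)
  also have "(\<integral>\<^sup>+x. indicator {0..} x * (indicator {-c..c} x * ennreal (\<bar>x\<bar> powr a)) \<partial>lborel) =
      (\<integral>\<^sup>+x. indicator {0..c} x * ennreal (x powr a) \<partial>lborel)"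
    using assms(2) by (intro nn_integral_cong) (auto simp: indicator_def)
  also have "\<dots> = ennreal (c powr (a + 1) / (a + 1))"
    by (rule nn_integral_powr_from_0[OF assms])
  finally show ?thesis using assms by (subst ennreal_mult') auto
qed

section \<open>Bounds for increments\<close>

text \<open>Cauchy-Schwarz for |s|^(-1/4) and |s|^(1/4) |g|; the integral of |s|^(-1/2) over [-b, b]
  is 4 b^(1/2). The weight makes the later integral over h converge: an unweighted estimate would
  leave the power h^(-1) and a logarithmic divergence. Any exponent strictly between 0 and 1 in
  place of 1/2 would serve.\<close>

lemma seg_integral_hardy:
  fixes g :: "real \<times> real \<Rightarrow> real"
  assumes [measurable]: "g \<in> borel_measurable borel" and z: "b > 0" "- b \<le> z" "z + h \<le> b"
  shows "ennreal ((seg_integral h (0, 1) g (x, z))\<^sup>2) \<le>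
    ennreal (4 * b powr (1/2)) * (\<integral>\<^sup>+s. indicator {-b..b} s * ennreal (\<bar>s\<bar> powr (1/2) * (g (x, s))\<^sup>2) \<partial>lborel)"
proof -
  let ?i = "indicator {-b..b} :: real \<Rightarrow> ennreal"
  have gx[measurable]: "(\<lambda>s. g (x, s)) \<in> borel_measurable borel" by simp
  have "ennreal ((seg_integral h (0, 1) g (x, z))\<^sup>2) \<le> (\<integral>\<^sup>+t. ennreal \<bar>indicator {0..h} t * g (x, z + t)\<bar> \<partial>lborel)\<^sup>2"
    unfolding seg_integral_def using integral_square_le[of lborel "\<lambda>t. indicator {0..h} t * g (x, z + t)"] by simp
  also have "(\<integral>\<^sup>+t. ennreal \<bar>indicator {0..h} t * g (x, z + t)\<bar> \<partial>lborel) \<le> (\<integral>\<^sup>+t. ?i (t + z) * ennreal \<bar>g (x, t + z)\<bar> \<partial>lborel)"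
    using z by (intro nn_integral_mono) (auto simp: indicator_def add.commute)
  also have "\<dots> = (\<integral>\<^sup>+s. ?i s * ennreal \<bar>g (x, s)\<bar> \<partial>lborel)"
    by (rule nn_integral_shift[where f="\<lambda>s. ?i s * ennreal \<bar>g (x, s)\<bar>"]) measurable
  \<comment> \<open>Since \<open>0 powr a\<close> is 0, the factorisation can fail at s = 0, a null
    set.\<close>
  also have "\<dots> = (\<integral>\<^sup>+s. (?i s * ennreal (\<bar>s\<bar> powr (-1/4))) * (?i s * ennreal (\<bar>s\<bar> powr (1/4) * \<bar>g (x, s)\<bar>)) \<partial>lborel)"
  proof (rule nn_integral_cong_AE)
    show "AE s in lborel. ?i s * ennreal \<bar>g (x, s)\<bar> = (?i s * ennreal (\<bar>s\<bar> powr (-1/4))) * (?i s * ennreal (\<bar>s\<bar> powr (1/4) * \<bar>g (x, s)\<bar>))"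
      using AE_lborel_singleton[of 0]
    proof eventually_elim
      case (elim s)
      have "\<bar>g (x, s)\<bar> = \<bar>s\<bar> powr (-1/4) * (\<bar>s\<bar> powr (1/4) * \<bar>g (x, s)\<bar>)"
        using elim by (simp add: mult.assoc[symmetric] powr_add[symmetric])
      then have "ennreal \<bar>g (x, s)\<bar> = ennreal (\<bar>s\<bar> powr (-1/4)) * ennreal (\<bar>s\<bar> powr (1/4) * \<bar>g (x, s)\<bar>)"
        by (subst ennreal_mult'[symmetric]) (auto simp only: powr_ge_zero)
      then show ?case by (cases "s \<in> {-b..b}") auto
    qed
  qed
  also have "\<dots>\<^sup>2 \<le> (\<integral>\<^sup>+s. (?i s * ennreal (\<bar>s\<bar> powr (-1/4)))\<^sup>2 \<partial>lborel) * (\<integral>\<^sup>+s. (?i s * ennreal (\<bar>s\<bar> powr (1/4) * \<bar>g (x, s)\<bar>))\<^sup>2 \<partial>lborel)"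
    by (rule Cauchy_Schwarz_nn_integral) measurable
  also have "(\<lambda>s. (?i s * ennreal (\<bar>s\<bar> powr (-1/4)))\<^sup>2) = (\<lambda>s. ?i s * ennreal (\<bar>s\<bar> powr (-1/2)))"
    by (auto simp: fun_eq_iff indicator_def ennreal_power)
       (auto simp: power2_eq_square powr_add[symmetric])
  also have "(\<lambda>s. (?i s * ennreal (\<bar>s\<bar> powr (1/4) * \<bar>g (x, s)\<bar>))\<^sup>2) = (\<lambda>s. ?i s * ennreal (\<bar>s\<bar> powr (1/2) * (g (x, s))\<^sup>2))"
    by (auto simp: fun_eq_iff indicator_def ennreal_power power_mult_distrib)
       (auto simp: power2_eq_square powr_add[symmetric])
  also have "(\<integral>\<^sup>+s. ?i s * ennreal (\<bar>s\<bar> powr (-1/2)) \<partial>lborel) = ennreal (4 * b powr (1/2))"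
    using nn_integral_abs_powr[of "-1/2" b] z by simp
  finally show ?thesis by (simp add: power_mono)
qed

text \<open>The increment is the horizontal segment integral of g divided by z, and |z| \<ge> d > 0
  makes the division safe. Height is constant along the segment, so the same weight
  \<open>?W\<close> stands on both sides of the weighted bound.\<close>

lemma x_difference_bound:
  assumes \<phi>: "L2 \<phi>" and g: "L2 g" and w: "weak_z_dx \<phi> g" and h: "h > 0" and d: "d > 0"
  shows "(\<integral>\<^sup>+p. indicator {z. d \<le> \<bar>z\<bar>} (snd p) * ennreal ((\<phi> (p + (h, 0)) - \<phi> p)\<^sup>2) \<partial>lborel) \<le>
    ennreal (h\<^sup>2) * (\<integral>\<^sup>+p. indicator {z. d \<le> \<bar>z\<bar>} (snd p) * ennreal ((g p)\<^sup>2 / (snd p)\<^sup>2) \<partial>lborel)"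
proof -
  have [measurable]: "\<phi> \<in> borel_measurable borel" "g \<in> borel_measurable borel"
    using \<phi> g by (auto simp: L2_def)
  let ?W = "\<lambda>p::real \<times> real. indicator {z. d \<le> \<bar>z\<bar>} (snd p) * ennreal (1 / (snd p)\<^sup>2)"
  have m: "?W \<in> borel_measurable borel"
    by measurable
  have "(\<integral>\<^sup>+p. indicator {z. d \<le> \<bar>z\<bar>} (snd p) * ennreal ((\<phi> (p + (h, 0)) - \<phi> p)\<^sup>2) \<partial>lborel) \<le>
      (\<integral>\<^sup>+p. ?W p * ennreal ((seg_integral h (1, 0) g p)\<^sup>2) \<partial>lborel)"
  proof (rule nn_integral_mono_AE)
    show "AE p in lborel. indicator {z. d \<le> \<bar>z\<bar>} (snd p) * ennreal ((\<phi> (p + (h, 0)) - \<phi> p)\<^sup>2) \<le> ?W p * ennreal ((seg_integral h (1, 0) g p)\<^sup>2)"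
      using weak_z_dx_AE_diff[OF \<phi> g w h]
    proof eventually_elim
      case (elim p)
      show ?case
        unfolding elim[symmetric] using d
        by (cases "d \<le> \<bar>snd p\<bar>") (auto simp: ennreal_mult'[symmetric] power_mult_distrib intro!: ennreal_leI)
    qed
  qed
  also have "\<dots> \<le> ennreal (h\<^sup>2) * (\<integral>\<^sup>+p. ?W p * ennreal ((g p)\<^sup>2) \<partial>lborel)"
    by (rule seg_integral_weighted_bound) (use h m in auto)
  also have "(\<lambda>p. ?W p * ennreal ((g p)\<^sup>2)) = (\<lambda>p. indicator {z. d \<le> \<bar>z\<bar>} (snd p) * ennreal ((g p)\<^sup>2 / (snd p)\<^sup>2))"
    by (auto simp: fun_eq_iff mult.assoc ennreal_mult'[symmetric])
  finally show ?thesis .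
qed

text \<open>A forward difference based at p: for |z| < d and a = 2d the other two heights, z + 2d
  and z + 4d, both exceed d.\<close>

definition z_diff2 :: "real \<Rightarrow> (real \<times> real \<Rightarrow> real) \<Rightarrow> real \<times> real \<Rightarrow> real" where
  "z_diff2 a \<phi> p = \<phi> (p + (0, 2 * a)) - 2 * \<phi> (p + (0, a)) + \<phi> p"

text \<open>The second difference is a difference of two first differences, each a segment integral
  of g. Integrability along both segments allows them to be subtracted under one integral
  sign.\<close>

lemma z_diff2_AE:
  assumes \<phi>: "L2 \<phi>" and g: "L2 g" and w: "weak_dz \<phi> g" and a: "a > 0"
  shows "AE p in lborel. z_diff2 a \<phi> p = seg_integral a (0, 1) (\<lambda>p. g (p + (0, a)) - g p) p"
proof -
  note D = weak_dz_AE_diff[OF \<phi> g w a]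
  note I = AE_shift_integrable[OF g, of a "(0, 1)"]
  show ?thesis
    using D AE_shift[OF D, of "(0, a)"] I AE_shift[OF I, of "(0, a)"]
  proof eventually_elim
    case (elim p)
    have "z_diff2 a \<phi> p = seg_integral a (0, 1) g (p + (0, a)) - seg_integral a (0, 1) g p"
      unfolding elim(1,2)[symmetric] z_diff2_def by (simp add: add.assoc)
    also have "\<dots> = seg_integral a (0, 1) (\<lambda>p. g (p + (0, a)) - g p) p"
      unfolding seg_integral_def using elim(3,4)
      by (subst Bochner_Integration.integral_diff[symmetric]) (auto simp: right_diff_distrib add_ac)
    finally show ?case .
  qed
qed

text \<open>Two vertical steps of length at most 2d lead from |z| < d through |z| < 3d into |z|
  \<le> 5d. The first is handled by the weighted bound, the second by the Hardy estimate; 24 d^3 is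
  (2d)^2 times the length 6d of the middle strip.\<close>

lemma z_diff2_bound:
  assumes \<phi>: "L2 \<phi>" and g: "L2 g" and k: "L2 k" and w: "weak_dz \<phi> g" and w2: "weak_dzz \<phi> k" and d: "d > 0"
  shows "(\<integral>\<^sup>+p. indicator {z. \<bar>z\<bar> < d} (snd p) * ennreal ((z_diff2 (2 * d) \<phi> p)\<^sup>2) \<partial>lborel) \<le>
    ennreal (24 * d ^ 3 * (4 * (5 * d) powr (1/2))) * (\<integral>\<^sup>+p. indicator {-(5*d)..5*d} (snd p) * ennreal (\<bar>snd p\<bar> powr (1/2) * (k p)\<^sup>2) \<partial>lborel)"
proof -
  have [measurable]: "\<phi> \<in> borel_measurable borel" "g \<in> borel_measurable borel" "k \<in> borel_measurable borel"
    using \<phi> g k by (auto simp: L2_def)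
  let ?a = "2 * d"
  let ?\<Delta> = "\<lambda>p. g (p + (0, ?a)) - g p"
  let ?H = "\<lambda>x. \<integral>\<^sup>+s. indicator {-(5*d)..5*d} s * ennreal (\<bar>s\<bar> powr (1/2) * (k (x, s))\<^sup>2) \<partial>lborel"
  let ?c = "4 * (5 * d) powr (1/2)"
  have m[measurable]: "(\<lambda>p. indicator {z. \<bar>z\<bar> < e} (snd p) :: ennreal) \<in> borel_measurable (borel :: (real \<times> real) measure)" for e :: real
    by measurable
  have "(\<integral>\<^sup>+p. indicator {z. \<bar>z\<bar> < d} (snd p) * ennreal ((z_diff2 ?a \<phi> p)\<^sup>2) \<partial>lborel)
     = (\<integral>\<^sup>+p. indicator {z. \<bar>z\<bar> < d} (snd p) * ennreal ((seg_integral ?a (0, 1) ?\<Delta> p)\<^sup>2) \<partial>lborel)"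
    by (rule nn_integral_cong_AE) (use z_diff2_AE[OF \<phi> g w, of ?a] d in \<open>auto elim: eventually_mono\<close>)
  also have "\<dots> \<le> ennreal (?a\<^sup>2) * (\<integral>\<^sup>+p. indicator {z. \<bar>z\<bar> < 3 * d} (snd p) * ennreal ((?\<Delta> p)\<^sup>2) \<partial>lborel)"
    by (rule seg_integral_weighted_bound) (use d m in \<open>auto split: split_indicator\<close>)
  also have "(\<integral>\<^sup>+p. indicator {z. \<bar>z\<bar> < 3 * d} (snd p) * ennreal ((?\<Delta> p)\<^sup>2) \<partial>lborel)
     = (\<integral>\<^sup>+p. indicator {z. \<bar>z\<bar> < 3 * d} (snd p) * ennreal ((seg_integral ?a (0, 1) k p)\<^sup>2) \<partial>lborel)"
    by (rule nn_integral_cong_AE)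
       (use weak_dzz_AE_diff[OF g k w w2, of ?a] d in \<open>auto elim: eventually_mono\<close>)
  also have "\<dots> = (\<integral>\<^sup>+x. \<integral>\<^sup>+z. indicator {z. \<bar>z\<bar> < 3 * d} z * ennreal ((seg_integral ?a (0, 1) k (x, z))\<^sup>2) \<partial>lborel \<partial>lborel)"
    by (subst nn_integral_pair) simp_all
  also have "\<dots> \<le> (\<integral>\<^sup>+x. \<integral>\<^sup>+z. indicator {z. \<bar>z\<bar> < 3 * d} z * (ennreal ?c * ?H x) \<partial>lborel \<partial>lborel)"
  proof (intro nn_integral_mono)
    fix x z
    show "indicator {z. \<bar>z\<bar> < 3 * d} z * ennreal ((seg_integral ?a (0, 1) k (x, z))\<^sup>2) \<le> indicator {z. \<bar>z\<bar> < 3 * d} z * (ennreal ?c * ?H x)"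
      using d seg_integral_hardy[of k "5 * d" z ?a x] by (cases "\<bar>z\<bar> < 3 * d") auto
  qed
  also have "\<dots> = (\<integral>\<^sup>+x. ennreal (6 * d) * (ennreal ?c * ?H x) \<partial>lborel)"
  proof (intro nn_integral_cong)
    fix x
    have "{z. \<bar>z\<bar> < 3 * d} = {- (3 * d) <..< 3 * d}" by auto
    then have "emeasure lborel {z. \<bar>z\<bar> < 3 * d} = ennreal (6 * d)" using d by simp
    then show "(\<integral>\<^sup>+z. indicator {z. \<bar>z\<bar> < 3 * d} z * (ennreal ?c * ?H x) \<partial>lborel) = ennreal (6 * d) * (ennreal ?c * ?H x)"
      by (subst nn_integral_multc) simp_all
  qed
  also have "\<dots> = ennreal (6 * d) * (ennreal ?c * (\<integral>\<^sup>+x. ?H x \<partial>lborel))"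
    by (simp add: nn_integral_cmult)
  also have "(\<integral>\<^sup>+x. ?H x \<partial>lborel) = (\<integral>\<^sup>+p. indicator {-(5*d)..5*d} (snd p) * ennreal (\<bar>snd p\<bar> powr (1/2) * (k p)\<^sup>2) \<partial>lborel)"
    by (subst nn_integral_pair) simp_all
  also have "ennreal (?a\<^sup>2) * (ennreal (6 * d) * (ennreal ?c * X)) = ennreal (24 * d ^ 3 * ?c) * X" for X
  proof -
    have "24 * d ^ 3 * ?c = ?a\<^sup>2 * (6 * d * ?c)" by (simp add: power2_eq_square power3_eq_cube)
    then show ?thesis using d by (simp only: ennreal_mult'' ennreal_mult' zero_le_power2 mult.assoc)
  qed
  finally show ?thesis by (simp add: mult_left_mono)
qed

section \<open>Integration over the step size\<close>

lemma cube_powr: "x > 0 \<Longrightarrow> (x ^ 3) powr a = x powr (3 * a)" for x :: real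
  using powr_powr[of x 3 a] by (simp add: powr_numeral)

lemma powr_third_cubed: "h \<ge> 0 \<Longrightarrow> (h powr (1/3)) ^ 3 = h" for h :: real
proof -
  assume "h \<ge> 0"
  then have "(h powr (1/3)) ^ 3 = (h powr (1/3)) powr 3" by (cases "h = 0") (simp_all add: powr_numeral)
  also have "\<dots> = h" using \<open>h \<ge> 0\<close> by (simp only: powr_powr) simp
  finally show ?thesis .
qed

text \<open>Cauchy-Schwarz for four terms; the six squares are those of the pairwise differences of
  2a, -b, c, -e in Lagrange's identity.\<close>

lemma four_squares:
  fixes a b c e :: real
  shows "(2 * a - b + c - e)\<^sup>2 \<le> 16 * a\<^sup>2 + 4 * b\<^sup>2 + 4 * c\<^sup>2 + 4 * e\<^sup>2"
proof -
  have "16 * a\<^sup>2 + 4 * b\<^sup>2 + 4 * c\<^sup>2 + 4 * e\<^sup>2 - (2 * a - b + c - e)\<^sup>2 =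
    (2 * a + b)\<^sup>2 + (2 * a - c)\<^sup>2 + (2 * a + e)\<^sup>2 + (b + c)\<^sup>2 + (b - e)\<^sup>2 + (c + e)\<^sup>2"
    by (simp add: power2_eq_square algebra_simps)
  also have "\<dots> \<ge> 0" by simp
  finally show ?thesis by simp
qed

text \<open>Inside the strip the x-increment is expressed by increments at two heights outside it
  and by two second differences. After translation the outer integral is counted 1 + 16 + 4 = 21
  times and the inner one 4 + 4 = 8 times.\<close>

lemma x_difference_split:
  fixes \<phi> :: "real \<times> real \<Rightarrow> real"
  assumes [measurable]: "\<phi> \<in> borel_measurable borel" and d: "d > 0"
  shows "(\<integral>\<^sup>+p. ennreal ((\<phi> (p + (h, 0)) - \<phi> p)\<^sup>2) \<partial>lborel) \<le>
     21 * (\<integral>\<^sup>+p. indicator {z. d \<le> \<bar>z\<bar>} (snd p) * ennreal ((\<phi> (p + (h, 0)) - \<phi> p)\<^sup>2) \<partial>lborel)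
     + 8 * (\<integral>\<^sup>+p. indicator {z. \<bar>z\<bar> < d} (snd p) * ennreal ((z_diff2 (2 * d) \<phi> p)\<^sup>2) \<partial>lborel)"
proof -
  let ?D = "\<lambda>p. \<phi> (p + (h, 0)) - \<phi> p" and ?S = "z_diff2 (2 * d) \<phi>"
  have [measurable]: "?S \<in> borel_measurable borel"
    unfolding z_diff2_def by measurable
  define P where "P = (\<lambda>p. indicator {z. d \<le> \<bar>z\<bar>} (snd p) * ennreal ((?D p)\<^sup>2))"
  define Q where "Q = (\<lambda>p. indicator {z. \<bar>z\<bar> < d} (snd p) * ennreal ((?S p)\<^sup>2))"
  have P[measurable]: "P \<in> borel_measurable borel" and Q[measurable]: "Q \<in> borel_measurable borel"
    unfolding P_def Q_def by measurable
  have "ennreal ((?D p)\<^sup>2) \<le> P p + (16 * P (p + (0, 2 * d)) + 4 * P (p + (0, 4 * d)) + 4 * Q (p + (h, 0)) + 4 * Q p)" for p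
  proof (cases "\<bar>snd p\<bar> < d")
    case False
    then show ?thesis by (simp add: P_def add_increasing2)
  next
    case True
    \<comment> \<open>The second z-difference of \<open>?D\<close> equals the x-increment of
      \<open>?S\<close>; this is that identity solved for \<open>?D p\<close>.\<close>
    have eq: "?D p = 2 * ?D (p + (0, 2 * d)) - ?D (p + (0, 4 * d)) + ?S (p + (h, 0)) - ?S p"
      by (simp add: z_diff2_def add_ac)
    have "ennreal ((?D p)\<^sup>2) \<le> ennreal (16 * (?D (p + (0, 2 * d)))\<^sup>2 + 4 * (?D (p + (0, 4 * d)))\<^sup>2 + 4 * (?S (p + (h, 0)))\<^sup>2 + 4 * (?S p)\<^sup>2)"
      by (subst eq) (intro ennreal_leI four_squares)
    also have "\<dots> = 16 * ennreal ((?D (p + (0, 2 * d)))\<^sup>2) + 4 * ennreal ((?D (p + (0, 4 * d)))\<^sup>2) + 4 * ennreal ((?S (p + (h, 0)))\<^sup>2) + 4 * ennreal ((?S p)\<^sup>2)"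
      by (simp add: ennreal_mult')
    also have "\<dots> = 16 * P (p + (0, 2 * d)) + 4 * P (p + (0, 4 * d)) + 4 * Q (p + (h, 0)) + 4 * Q p"
    proof -
      have "d \<le> \<bar>snd (p + (0, 2 * d))\<bar>" "d \<le> \<bar>snd (p + (0, 4 * d))\<bar>" "\<bar>snd (p + (h, 0))\<bar> < d"
        using True d by auto
      with True show ?thesis by (simp only: P_def Q_def indicator_simps mem_Collect_eq mult_1)
    qed
    finally show ?thesis by (simp add: add_increasing)
  qed
  then have "(\<integral>\<^sup>+p. ennreal ((?D p)\<^sup>2) \<partial>lborel) \<le>
      (\<integral>\<^sup>+p. P p + (16 * P (p + (0, 2 * d)) + 4 * P (p + (0, 4 * d)) + 4 * Q (p + (h, 0)) + 4 * Q p) \<partial>lborel)"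
    by (intro nn_integral_mono)
  also have "\<dots> = integral\<^sup>N lborel P + (16 * integral\<^sup>N lborel P + 4 * integral\<^sup>N lborel P + 4 * integral\<^sup>N lborel Q + 4 * integral\<^sup>N lborel Q)"
    by (simp add: nn_integral_add nn_integral_cmult nn_integral_shift[OF P] nn_integral_shift[OF Q])
  also have "\<dots> = 21 * integral\<^sup>N lborel P + 8 * integral\<^sup>N lborel Q"
  proof -
    have "(21::ennreal) = 1 + 16 + 4" "(8::ennreal) = 4 + 4" by simp_all
    then show ?thesis by (simp only: distrib_right mult_1 add_ac)
  qed
  finally show ?thesis by (simp add: P_def Q_def)
qed

text \<open>Substitute y = x + h, exchange the integrals in x and h, and use that N is even, by
  translation with (h, 0). Only steps h \<ge> 0 then remain to be estimated.\<close>

lemma Gagliardo_eq: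
  fixes \<phi> :: "real \<times> real \<Rightarrow> real"
  assumes [measurable]: "\<phi> \<in> borel_measurable borel"
  defines "N \<equiv> \<lambda>h. \<integral>\<^sup>+p. ennreal ((\<phi> (p + (h, 0)) - \<phi> p)\<^sup>2) \<partial>lborel"
  shows "(\<integral>\<^sup>+x. \<integral>\<^sup>+y. \<integral>\<^sup>+z. ennreal ((\<phi> (x, z) - \<phi> (y, z))\<^sup>2 / \<bar>x - y\<bar> powr (7/3)) \<partial>lborel \<partial>lborel \<partial>lborel)
    = 2 * (\<integral>\<^sup>+h. indicator {0..} h * (ennreal (\<bar>h\<bar> powr (-7/3)) * N h) \<partial>lborel)"
proof -
  have [measurable]: "(\<lambda>p. \<phi> (fst p, snd p)) \<in> borel_measurable (borel \<Otimes>\<^sub>M borel)"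
    by (simp add: borel_prod)
  have N[measurable]: "N \<in> borel_measurable borel" unfolding N_def by measurable
  have N_eq: "N h = (\<integral>\<^sup>+x. \<integral>\<^sup>+z. ennreal ((\<phi> (x, z) - \<phi> (x + h, z))\<^sup>2) \<partial>lborel \<partial>lborel)" for h
    unfolding N_def by (subst nn_integral_pair) (simp_all add: power2_commute)
  have "(\<integral>\<^sup>+x. \<integral>\<^sup>+y. \<integral>\<^sup>+z. ennreal ((\<phi> (x, z) - \<phi> (y, z))\<^sup>2 / \<bar>x - y\<bar> powr (7/3)) \<partial>lborel \<partial>lborel \<partial>lborel)
    = (\<integral>\<^sup>+x. \<integral>\<^sup>+h. \<integral>\<^sup>+z. ennreal (\<bar>h\<bar> powr (-7/3)) * ennreal ((\<phi> (x, z) - \<phi> (x + h, z))\<^sup>2) \<partial>lborel \<partial>lborel \<partial>lborel)"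
  proof (rule nn_integral_cong)
    fix x
    have "(\<integral>\<^sup>+y. \<integral>\<^sup>+z. ennreal ((\<phi> (x, z) - \<phi> (y, z))\<^sup>2 / \<bar>x - y\<bar> powr (7/3)) \<partial>lborel \<partial>lborel) =
      (\<integral>\<^sup>+h. \<integral>\<^sup>+z. ennreal ((\<phi> (x, z) - \<phi> (h + x, z))\<^sup>2 / \<bar>x - (h + x)\<bar> powr (7/3)) \<partial>lborel \<partial>lborel)"
      by (rule nn_integral_shift[symmetric, where f="\<lambda>y. \<integral>\<^sup>+z. ennreal ((\<phi> (x, z) - \<phi> (y, z))\<^sup>2 / \<bar>x - y\<bar> powr (7/3)) \<partial>lborel"]) measurable
    also have "\<dots> = (\<integral>\<^sup>+h. \<integral>\<^sup>+z. ennreal (\<bar>h\<bar> powr (-7/3)) * ennreal ((\<phi> (x, z) - \<phi> (x + h, z))\<^sup>2) \<partial>lborel \<partial>lborel)"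
    proof (intro nn_integral_cong)
      fix h z
      \<comment> \<open>This includes the diagonal h = 0, where both sides are 0.\<close>
      have "(\<phi> (x, z) - \<phi> (h + x, z))\<^sup>2 / \<bar>x - (h + x)\<bar> powr (7/3) = \<bar>h\<bar> powr (-7/3) * (\<phi> (x, z) - \<phi> (x + h, z))\<^sup>2"
        using powr_minus_divide[of "\<bar>h\<bar>" "7/3"] by (simp add: add.commute)
      then show "ennreal ((\<phi> (x, z) - \<phi> (h + x, z))\<^sup>2 / \<bar>x - (h + x)\<bar> powr (7/3)) =
          ennreal (\<bar>h\<bar> powr (-7/3)) * ennreal ((\<phi> (x, z) - \<phi> (x + h, z))\<^sup>2)"
        by (simp only: ennreal_mult' powr_ge_zero)
    qed
    finally show "(\<integral>\<^sup>+y. \<integral>\<^sup>+z. ennreal ((\<phi> (x, z) - \<phi> (y, z))\<^sup>2 / \<bar>x - y\<bar> powr (7/3)) \<partial>lborel \<partial>lborel) = \<dots>" .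
  qed
  also have "\<dots> = (\<integral>\<^sup>+h. \<integral>\<^sup>+x. \<integral>\<^sup>+z. ennreal (\<bar>h\<bar> powr (-7/3)) * ennreal ((\<phi> (x, z) - \<phi> (x + h, z))\<^sup>2) \<partial>lborel \<partial>lborel \<partial>lborel)"
    by (rule lborel_pair.Fubini') measurable
  also have "\<dots> = (\<integral>\<^sup>+h. ennreal (\<bar>h\<bar> powr (-7/3)) * N h \<partial>lborel)"
    unfolding N_eq by (intro nn_integral_cong) (simp add: nn_integral_cmult)
  also have "\<dots> = 2 * (\<integral>\<^sup>+h. indicator {0..} h * (ennreal (\<bar>h\<bar> powr (-7/3)) * N h) \<partial>lborel)"
  proof (rule nn_integral_even)
    fix h
    have "N (- h) = N h"
      unfolding N_def
      using nn_integral_shift[of "\<lambda>p. ennreal ((\<phi> (p + (- h, 0)) - \<phi> p)\<^sup>2)" "(h, 0)"]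
      by (simp add: add.assoc power2_commute zero_prod_def[symmetric])
    then show "ennreal (\<bar>- h\<bar> powr (-7/3)) * N (- h) = ennreal (\<bar>h\<bar> powr (-7/3)) * N h" by simp
  qed measurable
  finally show ?thesis .
qed

text \<open>The set moves with h, and exchanging the integrals needs measurability jointly in h and
  p. It becomes visible once the indicator is written as a comparison of measurable
  functions.\<close>

lemma outer_indicator_measurable [measurable]:
  "(\<lambda>(h, p :: real \<times> real). indicator {z. h powr (1/3) \<le> \<bar>z\<bar>} (snd p) :: ennreal) \<in> borel_measurable (lborel \<Otimes>\<^sub>M lborel)"
proof -
  have "(\<lambda>q :: real \<times> real \<times> real. if fst q powr (1/3) \<le> \<bar>snd (snd q)\<bar> then 1 else 0 :: ennreal) \<in> borel_measurable (lborel \<Otimes>\<^sub>M lborel)"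
    by measurable
  then show ?thesis by (simp add: indicator_def of_bool_def case_prod_beta')
qed

lemma inner_indicator_measurable [measurable]:
  "(\<lambda>(h, p :: real \<times> real). indicator {-(5 * h powr (1/3))..5 * h powr (1/3)} (snd p) :: ennreal) \<in> borel_measurable (lborel \<Otimes>\<^sub>M lborel)"
proof -
  have "(\<lambda>q :: real \<times> real \<times> real. if -(5 * fst q powr (1/3)) \<le> snd (snd q) \<and> snd (snd q) \<le> 5 * fst q powr (1/3) then 1 else 0 :: ennreal) \<in> borel_measurable (lborel \<Otimes>\<^sub>M lborel)"
    by measurable
  then show ?thesis by (simp add: indicator_def of_bool_def case_prod_beta')
qed

text \<open>Here h^(-1/3) is h^(-7/3) h^2. After Fubini the condition on h for fixed z is h \<le>
  |z|^3, and over this range h^(-1/3) integrates to (3/2) |z|^2, which cancels the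
  denominator.\<close>

lemma weighted_x_bound:
  fixes g :: "real \<times> real \<Rightarrow> real"
  assumes [measurable]: "g \<in> borel_measurable borel"
  shows "(\<integral>\<^sup>+h. indicator {0..} h * (ennreal (h powr (-1/3)) *
      (\<integral>\<^sup>+p. indicator {z. h powr (1/3) \<le> \<bar>z\<bar>} (snd p) * ennreal ((g p)\<^sup>2 / (snd p)\<^sup>2) \<partial>lborel)) \<partial>lborel)
    \<le> ennreal (3/2) * (\<integral>\<^sup>+p. ennreal ((g p)\<^sup>2) \<partial>lborel)"
proof -
  let ?f = "\<lambda>h p. indicator {z. h powr (1/3) \<le> \<bar>z\<bar>} (snd p) * ennreal ((g p)\<^sup>2 / (snd p)\<^sup>2)"
  have "(\<integral>\<^sup>+h. indicator {0..} h * (ennreal (h powr (-1/3)) * (\<integral>\<^sup>+p. ?f h p \<partial>lborel)) \<partial>lborel)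
    = (\<integral>\<^sup>+h. \<integral>\<^sup>+p. indicator {0..} h * (ennreal (h powr (-1/3)) * ?f h p) \<partial>lborel \<partial>lborel)"
    by (simp add: nn_integral_cmult)
  also have "\<dots> = (\<integral>\<^sup>+p. \<integral>\<^sup>+h. indicator {0..} h * (ennreal (h powr (-1/3)) * ?f h p) \<partial>lborel \<partial>lborel)"
    by (rule lborel_pair.Fubini'[symmetric]) measurable
  also have "\<dots> \<le> (\<integral>\<^sup>+p. ennreal (3/2) * ennreal ((g p)\<^sup>2) \<partial>lborel)"
  proof (rule nn_integral_mono)
    fix p :: "real \<times> real"
    let ?z = "\<bar>snd p\<bar>"
    have "(\<integral>\<^sup>+h. indicator {0..} h * (ennreal (h powr (-1/3)) * ?f h p) \<partial>lborel)
      = (\<integral>\<^sup>+h. (indicator {0..?z ^ 3} h * ennreal (h powr (-1/3))) * ennreal ((g p)\<^sup>2 / (snd p)\<^sup>2) \<partial>lborel)"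
    proof (intro nn_integral_cong)
      fix h :: real
      have "h powr (1/3) \<le> ?z \<longleftrightarrow> h \<le> ?z ^ 3" if "h \<ge> 0"
      proof -
        have "h powr (1/3) \<le> ?z \<longleftrightarrow> (h powr (1/3)) ^ 3 \<le> ?z ^ 3"
          by (simp add: power_mono_iff)
        also have "(h powr (1/3)) ^ 3 = h"
          using that by (rule powr_third_cubed)
        finally show ?thesis .
      qed
      then show "indicator {0..} h * (ennreal (h powr (-1/3)) * ?f h p) = (indicator {0..?z ^ 3} h * ennreal (h powr (-1/3))) * ennreal ((g p)\<^sup>2 / (snd p)\<^sup>2)"
        by (auto simp: indicator_def)
    qed
    also have "\<dots> = ennreal ((?z ^ 3) powr (2/3) / (2/3)) * ennreal ((g p)\<^sup>2 / (snd p)\<^sup>2)"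
      by (subst nn_integral_multc) (simp_all add: nn_integral_powr_from_0)
    also have "\<dots> \<le> ennreal (3/2) * ennreal ((g p)\<^sup>2)"
    \<comment> \<open>On the line z = 0 the left side is 0, because division by 0 gives 0.\<close>
    proof (cases "snd p = 0")
      case False
      have "(?z ^ 3) powr (2/3) = (snd p)\<^sup>2"
        using False by (simp add: cube_powr powr_numeral)
      then show ?thesis using False by (simp add: ennreal_mult'[symmetric])
    qed simp
    finally show "(\<integral>\<^sup>+h. indicator {0..} h * (ennreal (h powr (-1/3)) * ?f h p) \<partial>lborel) \<le> ennreal (3/2) * ennreal ((g p)\<^sup>2)" .
  qed
  also have "\<dots> = ennreal (3/2) * (\<integral>\<^sup>+p. ennreal ((g p)\<^sup>2) \<partial>lborel)"
    by (rule nn_integral_cmult) measurable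
  finally show ?thesis .
qed

text \<open>Here h^(-7/6) is h^(-7/3) d^3 d^(1/2) with d = h^(1/3). For fixed z the condition on h
  is h \<ge> (|z|/5)^3, and over this range h^(-7/6) integrates to 6 (|z|/5)^(-1/2), which cancels
  the weight |z|^(1/2).\<close>

lemma weighted_z_bound:
  fixes k :: "real \<times> real \<Rightarrow> real"
  assumes [measurable]: "k \<in> borel_measurable borel"
  shows "(\<integral>\<^sup>+h. indicator {0..} h * (ennreal (h powr (-7/6)) *
      (\<integral>\<^sup>+p. indicator {-(5 * h powr (1/3))..5 * h powr (1/3)} (snd p) * ennreal (\<bar>snd p\<bar> powr (1/2) * (k p)\<^sup>2) \<partial>lborel)) \<partial>lborel)
    \<le> ennreal (6 * 5 powr (1/2)) * (\<integral>\<^sup>+p. ennreal ((k p)\<^sup>2) \<partial>lborel)"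
proof -
  let ?f = "\<lambda>h p. indicator {-(5 * h powr (1/3))..5 * h powr (1/3)} (snd p) * ennreal (\<bar>snd p\<bar> powr (1/2) * (k p)\<^sup>2)"
  have "(\<integral>\<^sup>+h. indicator {0..} h * (ennreal (h powr (-7/6)) * (\<integral>\<^sup>+p. ?f h p \<partial>lborel)) \<partial>lborel)
    = (\<integral>\<^sup>+h. \<integral>\<^sup>+p. indicator {0..} h * (ennreal (h powr (-7/6)) * ?f h p) \<partial>lborel \<partial>lborel)"
    by (simp add: nn_integral_cmult)
  also have "\<dots> = (\<integral>\<^sup>+p. \<integral>\<^sup>+h. indicator {0..} h * (ennreal (h powr (-7/6)) * ?f h p) \<partial>lborel \<partial>lborel)"
    by (rule lborel_pair.Fubini'[symmetric]) measurable
  also have "\<dots> \<le> (\<integral>\<^sup>+p. ennreal (6 * 5 powr (1/2)) * ennreal ((k p)\<^sup>2) \<partial>lborel)"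
  proof (rule nn_integral_mono)
    fix p :: "real \<times> real"
    let ?z = "\<bar>snd p\<bar>" and ?K = "ennreal (\<bar>snd p\<bar> powr (1/2) * (k p)\<^sup>2)"
    show "(\<integral>\<^sup>+h. indicator {0..} h * (ennreal (h powr (-7/6)) * ?f h p) \<partial>lborel) \<le> ennreal (6 * 5 powr (1/2)) * ennreal ((k p)\<^sup>2)"
    \<comment> \<open>The tail integral needs a positive lower limit; for z = 0 the weight
      \<open>0 powr (1/2)\<close> is 0 and the integrand vanishes.\<close>
    proof (cases "snd p = 0")
      case False
      have c: "(?z / 5) ^ 3 > 0" using False by simp
      have "(\<integral>\<^sup>+h. indicator {0..} h * (ennreal (h powr (-7/6)) * ?f h p) \<partial>lborel)
        = (\<integral>\<^sup>+h. (indicator {(?z / 5) ^ 3..} h * ennreal (h powr (-7/6))) * ?K \<partial>lborel)"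
      proof (intro nn_integral_cong)
        fix h :: real
        have "snd p \<in> {-(5 * h powr (1/3))..5 * h powr (1/3)} \<longleftrightarrow> (?z / 5) ^ 3 \<le> h" if "h \<ge> 0"
        proof -
          have "snd p \<in> {-(5 * h powr (1/3))..5 * h powr (1/3)} \<longleftrightarrow> ?z / 5 \<le> h powr (1/3)"
            by auto
          also have "\<dots> \<longleftrightarrow> (?z / 5) ^ 3 \<le> (h powr (1/3)) ^ 3"
            by (rule power_mono_iff[symmetric]) auto
          also have "(h powr (1/3)) ^ 3 = h"
            using that by (rule powr_third_cubed)
          finally show ?thesis .
        qed
        moreover have "h \<ge> 0" if "(?z / 5) ^ 3 \<le> h" using that c by linarith
        ultimately show "indicator {0..} h * (ennreal (h powr (-7/6)) * ?f h p) = (indicator {(?z / 5) ^ 3..} h * ennreal (h powr (-7/6))) * ?K"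
          by (cases "(?z / 5) ^ 3 \<le> h"; cases "h \<ge> 0") (auto simp: mult.assoc simp del: atLeastAtMost_iff)
      qed
      also have "\<dots> = ennreal (6 * ((?z / 5) ^ 3) powr (-1/6)) * ?K"
        using nn_integral_powr_to_inf[of "-7/6", OF _ c] by (subst nn_integral_multc) (simp_all add: mult.commute)
      also have "\<dots> = ennreal (6 * 5 powr (1/2)) * ennreal ((k p)\<^sup>2)"
      proof -
        have "((?z / 5) ^ 3) powr (-1/6) = (?z / 5) powr (-1/2)"
          using False by (subst cube_powr) simp_all
        also have "\<dots> = ?z powr (-1/2) * 5 powr (1/2)"
        proof -
          have "(?z / 5) powr (-1/2) = ?z powr (-1/2) / 5 powr (-1/2)" by (simp add: powr_divide)
          also have "5 powr (-1/2) = inverse (5 powr (1/2) :: real)" using powr_minus[of "5::real" "1/2"] by simp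
          finally show ?thesis by (simp only: divide_inverse inverse_inverse_eq)
        qed
        finally have "6 * ((?z / 5) ^ 3) powr (-1/6) * (?z powr (1/2) * (k p)\<^sup>2) = 6 * 5 powr (1/2) * (k p)\<^sup>2 * (?z powr (-1/2) * ?z powr (1/2))"
          by (simp only:) (simp only: mult_ac)
        also have "?z powr (-1/2) * ?z powr (1/2) = ?z powr (-1/2 + 1/2)"
          by (rule powr_add[symmetric])
        also have "\<dots> = 1" using False by simp
        finally have e: "6 * ((?z / 5) ^ 3) powr (-1/6) * (?z powr (1/2) * (k p)\<^sup>2) = 6 * 5 powr (1/2) * (k p)\<^sup>2"
          by (simp only: mult_1_right)
        have "ennreal (6 * ((?z / 5) ^ 3) powr (-1/6)) * ?K = ennreal (6 * ((?z / 5) ^ 3) powr (-1/6) * (?z powr (1/2) * (k p)\<^sup>2))"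
          by (rule ennreal_mult'[symmetric]) simp
        also have "\<dots> = ennreal (6 * 5 powr (1/2)) * ennreal ((k p)\<^sup>2)"
          unfolding e by (rule ennreal_mult') simp
        finally show ?thesis .
      qed
      finally show ?thesis by simp
    qed simp
  qed
  also have "\<dots> = ennreal (6 * 5 powr (1/2)) * (\<integral>\<^sup>+p. ennreal ((k p)\<^sup>2) \<partial>lborel)"
    by (rule nn_integral_cmult) measurable
  finally show ?thesis .
qed

text \<open>The choice d = h^(1/3) balances the outer size h/d of the increment against the inner
  size d^2. The exponents become -7/3 + 2 = -1/3 and -7/3 + 1 + 1/6 = -7/6, and 768 is 8 times 24
  times 4.\<close>

lemma difference_bound:
  assumes L: "L2 \<phi>" "L2 gz" "L2 gzz" "L2 gx" and w: "weak_dz \<phi> gz" "weak_dzz \<phi> gzz" "weak_z_dx \<phi> gx" and h: "h > 0"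
  shows "ennreal (h powr (-7/3)) * (\<integral>\<^sup>+p. ennreal ((\<phi> (p + (h, 0)) - \<phi> p)\<^sup>2) \<partial>lborel) \<le>
    21 * (ennreal (h powr (-1/3)) * (\<integral>\<^sup>+p. indicator {z. h powr (1/3) \<le> \<bar>z\<bar>} (snd p) * ennreal ((gx p)\<^sup>2 / (snd p)\<^sup>2) \<partial>lborel))
    + ennreal (768 * 5 powr (1/2)) * (ennreal (h powr (-7/6)) *
      (\<integral>\<^sup>+p. indicator {-(5 * h powr (1/3))..5 * h powr (1/3)} (snd p) * ennreal (\<bar>snd p\<bar> powr (1/2) * (gzz p)\<^sup>2) \<partial>lborel))"
    (is "_ * ?N \<le> 21 * (_ * ?A) + _ * (_ * ?B)")
proof -
  define d where "d = h powr (1/3)"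
  have d: "d > 0" using h by (simp add: d_def)
  have "\<phi> \<in> borel_measurable borel" using L(1) by (simp add: L2_def)
  note x_difference_split[OF this d, of h]
  also note x_difference_bound[OF L(1,4) w(3) h d]
  also note z_diff2_bound[OF L(1,2,3) w(1,2) d]
  finally have "?N \<le> 21 * (ennreal (h\<^sup>2) * ?A) + 8 * (ennreal (24 * d ^ 3 * (4 * (5 * d) powr (1/2))) * ?B)"
    unfolding d_def by (simp add: mult_left_mono add_mono)
  then have "ennreal (h powr (-7/3)) * ?N \<le> ennreal (h powr (-7/3)) * (21 * (ennreal (h\<^sup>2) * ?A) + 8 * (ennreal (24 * d ^ 3 * (4 * (5 * d) powr (1/2))) * ?B))"
    by (rule mult_left_mono) simp
  also have "\<dots> = 21 * (ennreal (h powr (-7/3) * h\<^sup>2) * ?A) + ennreal (h powr (-7/3) * (8 * (24 * d ^ 3 * (4 * (5 * d) powr (1/2))))) * ?B"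
  proof -
    have "ennreal a * (21 * (ennreal b * X) + 8 * (ennreal c * Y)) = 21 * (ennreal (a * b) * X) + ennreal (a * (8 * c)) * Y"
      if "a \<ge> 0" "b \<ge> 0" "c \<ge> 0" for a b c X Y
      using that by (simp add: distrib_left ennreal_mult mult_ac)
    then show ?thesis using d by (simp only: zero_le_power2 powr_ge_zero zero_le_power zero_le_mult_iff zero_le_numeral less_imp_le simp_thms)
  qed
  also have "h powr (-7/3) * h\<^sup>2 = h powr (-1/3)"
  proof -
    have "h powr (-7/3) * h powr 2 = h powr (-7/3 + 2)" by (simp only: powr_add)
    then show ?thesis using h by (simp add: powr_numeral)
  qed
  also have "h powr (-7/3) * (8 * (24 * d ^ 3 * (4 * (5 * d) powr (1/2)))) = 768 * 5 powr (1/2) * h powr (-7/6)"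
  proof -
    have "d ^ 3 = h" using h unfolding d_def by (intro powr_third_cubed) simp
    moreover have "(5 * d) powr (1/2) = 5 powr (1/2) * h powr (1/6)"
      using h by (simp add: d_def powr_mult powr_powr)
    ultimately have "h powr (-7/3) * (8 * (24 * d ^ 3 * (4 * (5 * d) powr (1/2)))) = 768 * 5 powr (1/2) * (h powr (-7/3) * h powr 1 * h powr (1/6))"
      using h by simp
    also have "h powr (-7/3) * h powr 1 * h powr (1/6) = h powr (-7/6)"
      by (simp only: powr_add[symmetric]) simp
    finally show ?thesis .
  qed
  also have "ennreal (768 * 5 powr (1/2) * h powr (-7/6)) * ?B = ennreal (768 * 5 powr (1/2)) * (ennreal (h powr (-7/6)) * ?B)"
    by (subst ennreal_mult') (simp_all add: mult.assoc)
  finally show ?thesis .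
qed

text \<open>The constant 63 is 2 times 21 times 3/2, and 46080 is 2 times 768 times 6 times 5. The
  factor 2 comes from restricting to h \<ge> 0, the 5 from the square of 5^(1/2).\<close>

lemma H23_sq_bound:
  assumes L: "L2 \<phi>" "L2 gz" "L2 gzz" "L2 gx" and w: "weak_dz \<phi> gz" "weak_dzz \<phi> gzz" "weak_z_dx \<phi> gx"
  shows "H23_sq \<phi> \<le> ennreal ((L2_norm \<phi>)\<^sup>2 + 63 * (L2_norm gx)\<^sup>2 + 46080 * (L2_norm gzz)\<^sup>2)"
proof -
  have [measurable]: "\<phi> \<in> borel_measurable borel" "gx \<in> borel_measurable borel" "gzz \<in> borel_measurable borel"
    using L by (auto simp: L2_def)
  have norm: "(\<integral>\<^sup>+p. ennreal ((f p)\<^sup>2) \<partial>lborel) = ennreal ((L2_norm f)\<^sup>2)" if "L2 f" for f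
    using that by (subst nn_integral_eq_integral) (auto simp: L2_def L2_norm_def)
  let ?N = "\<lambda>h. \<integral>\<^sup>+p. ennreal ((\<phi> (p + (h, 0)) - \<phi> p)\<^sup>2) \<partial>lborel"
  define A where "A = (\<lambda>h. ennreal (h powr (-1/3)) * (\<integral>\<^sup>+p. indicator {z. h powr (1/3) \<le> \<bar>z\<bar>} (snd p) * ennreal ((gx p)\<^sup>2 / (snd p)\<^sup>2) \<partial>lborel))"
  define B where "B = (\<lambda>h. ennreal (h powr (-7/6)) *
      (\<integral>\<^sup>+p. indicator {-(5 * h powr (1/3))..5 * h powr (1/3)} (snd p) * ennreal (\<bar>snd p\<bar> powr (1/2) * (gzz p)\<^sup>2) \<partial>lborel))"
  have "A \<in> borel_measurable lborel" "B \<in> borel_measurable lborel"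
    unfolding A_def B_def by measurable
  then have [measurable]: "A \<in> borel_measurable borel" "B \<in> borel_measurable borel"
    by simp_all
  have "(\<integral>\<^sup>+h. indicator {0..} h * (ennreal (\<bar>h\<bar> powr (-7/3)) * ?N h) \<partial>lborel) \<le>
     (\<integral>\<^sup>+h. 21 * (indicator {0..} h * A h) + ennreal (768 * 5 powr (1/2)) * (indicator {0..} h * B h) \<partial>lborel)"
  proof (rule nn_integral_mono)
    fix h :: real
    \<comment> \<open>\<open>difference_bound\<close> applies for h > 0. At h = 0 the factor
      \<open>0 powr (-7/3)\<close> is 0, and for h < 0 the indicators vanish.\<close>
    show "indicator {0..} h * (ennreal (\<bar>h\<bar> powr (-7/3)) * ?N h) \<le> 21 * (indicator {0..} h * A h) + ennreal (768 * 5 powr (1/2)) * (indicator {0..} h * B h)"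
      using difference_bound[OF L w, of h] unfolding A_def B_def by (cases "h > 0"; cases "h = 0") auto
  qed
  also have "\<dots> = 21 * (\<integral>\<^sup>+h. indicator {0..} h * A h \<partial>lborel) + ennreal (768 * 5 powr (1/2)) * (\<integral>\<^sup>+h. indicator {0..} h * B h \<partial>lborel)"
    by (simp add: nn_integral_add nn_integral_cmult)
  also have "\<dots> \<le> 21 * (ennreal (3/2) * ennreal ((L2_norm gx)\<^sup>2)) + ennreal (768 * 5 powr (1/2)) * (ennreal (6 * 5 powr (1/2)) * ennreal ((L2_norm gzz)\<^sup>2))"
    unfolding norm[OF L(3), symmetric] norm[OF L(4), symmetric] A_def B_def
    by (intro add_mono mult_left_mono weighted_x_bound weighted_z_bound) auto
  also have "\<dots> = ennreal (63/2 * (L2_norm gx)\<^sup>2 + 23040 * (L2_norm gzz)\<^sup>2)"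
  proof -
    have "768 * 5 powr (1/2) * (6 * 5 powr (1/2)) = 4608 * (5 powr (1/2) * 5 powr (1/2) :: real)" by simp
    also have "5 powr (1/2) * 5 powr (1/2) = (5 :: real)" by (simp add: powr_add[symmetric])
    finally have c: "768 * 5 powr (1/2) * (6 * 5 powr (1/2)) = (23040 :: real)" by simp
    have "ennreal (768 * 5 powr (1/2)) * (ennreal (6 * 5 powr (1/2)) * ennreal ((L2_norm gzz)\<^sup>2)) = ennreal (768 * 5 powr (1/2) * (6 * 5 powr (1/2)) * (L2_norm gzz)\<^sup>2)"
      by (simp only: ennreal_mult' ennreal_mult'' zero_le_power2 mult.assoc powr_ge_zero)
    moreover have "21 * (ennreal (3/2) * ennreal ((L2_norm gx)\<^sup>2)) = ennreal (21 * (3/2 * (L2_norm gx)\<^sup>2))"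
      by (subst ennreal_mult', simp, subst ennreal_mult', simp, simp)
    ultimately show ?thesis unfolding c by (simp add: ennreal_plus[symmetric] del: ennreal_plus)
  qed
  finally have "(\<integral>\<^sup>+h. indicator {0..} h * (ennreal (\<bar>h\<bar> powr (-7/3)) * ?N h) \<partial>lborel) \<le> ennreal (63/2 * (L2_norm gx)\<^sup>2 + 23040 * (L2_norm gzz)\<^sup>2)" .
  then have "H23_sq \<phi> \<le> ennreal ((L2_norm \<phi>)\<^sup>2) + 2 * ennreal (63/2 * (L2_norm gx)\<^sup>2 + 23040 * (L2_norm gzz)\<^sup>2)"
    unfolding H23_sq_def norm[OF L(1)] by (subst Gagliardo_eq) (measurable, intro add_left_mono mult_left_mono, simp_all only: zero_le)
  also have "\<dots> = ennreal ((L2_norm \<phi>)\<^sup>2 + 2 * (63/2 * (L2_norm gx)\<^sup>2 + 23040 * (L2_norm gzz)\<^sup>2))"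
  proof -
    have "ennreal a + 2 * ennreal b = ennreal (a + 2 * b)" if "a \<ge> 0" "b \<ge> 0" for a b
      using that by (simp add: ennreal_mult')
    then show ?thesis by (simp del: ennreal_plus)
  qed
  finally show ?thesis by (simp only: distrib_left mult.assoc[symmetric] add.assoc[symmetric]) (simp del: ennreal_plus)
qed

theorem proposition1p6:
  "\<exists>C>0. \<forall>\<phi> gz gzz gx.
     L2 \<phi> \<and> L2 gz \<and> L2 gzz \<and> L2 gx \<and>
     weak_dz \<phi> gz \<and> weak_dzz \<phi> gzz \<and> weak_z_dx \<phi> gx \<longrightarrow>
       H23_sq \<phi> < \<infinity> \<and>
       H23_norm \<phi> \<le> C * (L2_norm gx + L2_norm gzz + L2_norm gz + L2_norm \<phi>)"
proof (intro exI[of _ "300::real"] conjI allI impI)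
  fix \<phi> gz gzz gx
  assume "L2 \<phi> \<and> L2 gz \<and> L2 gzz \<and> L2 gx \<and> weak_dz \<phi> gz \<and> weak_dzz \<phi> gzz \<and> weak_z_dx \<phi> gx"
  then have b: "H23_sq \<phi> \<le> ennreal ((L2_norm \<phi>)\<^sup>2 + 63 * (L2_norm gx)\<^sup>2 + 46080 * (L2_norm gzz)\<^sup>2)"
    by (intro H23_sq_bound[of \<phi> gz gzz gx]) auto
  \<comment> \<open>Finiteness is a claim of its own: \<open>enn2real\<close> maps infinity to 0, so
    a bound on \<open>H23_norm\<close> alone would not exclude an infinite norm.\<close>
  show "H23_sq \<phi> < \<infinity>"
    by (rule order.strict_trans1[OF b]) simp
  have nn: "L2_norm f \<ge> 0" for f by (simp add: L2_norm_def)
  have "enn2real (H23_sq \<phi>) \<le> (L2_norm \<phi>)\<^sup>2 + 63 * (L2_norm gx)\<^sup>2 + 46080 * (L2_norm gzz)\<^sup>2"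
    using enn2real_mono[OF b] by (simp del: ennreal_plus)
  \<comment> \<open>90000 is the square of 300 and exceeds every coefficient. The sum of squares is
    then absorbed into the square of the sum, as all norms are nonnegative.\<close>
  also have "\<dots> \<le> 90000 * ((L2_norm \<phi>)\<^sup>2 + (L2_norm gx)\<^sup>2 + (L2_norm gzz)\<^sup>2)"
    using zero_le_power2[of "L2_norm \<phi>"] zero_le_power2[of "L2_norm gx"] zero_le_power2[of "L2_norm gzz"] by argo
  also have "\<dots> \<le> 90000 * (L2_norm gx + L2_norm gzz + L2_norm gz + L2_norm \<phi>)\<^sup>2"
    using nn[of \<phi>] nn[of gx] nn[of gz] nn[of gzz]
    by (auto simp: power2_eq_square algebra_simps intro!: add_nonneg_nonneg)
  also have "\<dots> = (300 * (L2_norm gx + L2_norm gzz + L2_norm gz + L2_norm \<phi>))\<^sup>2"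
    by (simp only: power_mult_distrib) simp
  finally have "sqrt (enn2real (H23_sq \<phi>)) \<le> sqrt ((300 * (L2_norm gx + L2_norm gzz + L2_norm gz + L2_norm \<phi>))\<^sup>2)"
    by (rule real_sqrt_le_mono)
  then show "H23_norm \<phi> \<le> 300 * (L2_norm gx + L2_norm gzz + L2_norm gz + L2_norm \<phi>)"
    unfolding H23_norm_def using nn by (simp add: add_nonneg_nonneg)
qed simp

end
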